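(* Let $S$ be a strongly amenable topological group and let $\mathscr{X}$ be a pointwise almost periodic, weakly mixing, quasi-separable, non-trivial $S$-flow with phase space $X$. Then: (1) $P(\mathscr{X})$ is not an equivalence relation. (2) There exists no closed proximal cell for $\mathscr{X}$, i.e. for no $x\in X$ is $P[x]$ closed in $X$. (Consequently, $\mathscr{X}$ is not point distal.)
   Context: Let $S$ be a topological group with identity $e$. An $S$-flow $\mathscr{X}$ is a compact Hausdorff space $X$ with a jointly continuous map $S\times X\to X$, $(t,x)\mapsto tx$, such that $ex=x$ and $(st)x=s(tx)$. It is minimal if $\overline{Sx}=X$ for all $x$; topologically transitive if $X=\overline{S[U]}$ for every nonempty open $U\subseteq X$; weakly mixing if $\mathscr{X}\times\mathscr{X}$ (with action $t(x,y)=(tx,ty)$) is topologically transitive. A point $x$ is almost periodic if $S$ acts minimally on $\overline{Sx}$; $\mathscr{X}$ is pointwise almost periodic if every point is almost periodic. An extension of $S$-flows is a continuous onto $S$-equivariant map. A flow is trivial if its phase space is a singleton. $\mathscr{X}$ is quasi-separable if $\mathscr{X}=\varprojlim\{\mathscr{X}_i\mid i\in\Lambda\}$ for some inverse system, over a directed set $\Lambda$, of $S$-flows $\mathscr{X}_i$ with metrizable phase spaces, whose link maps $\pi_{i,j}\colon\mathscr{X}_j\to\mathscr{X}_i$ ($i<j$) are extensions. Let $\Delta_X$ be the diagonal of $X\times X$. The proximal relation is $P(\mathscr{X})=\{(x,x')\in X\times X\mid\overline{S(x,x')}\cap\Delta_X\neq\emptyset\}$; the proximal cell at $x$ is $P[x]=\{x'\in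 X\mid(x,x')\in P(\mathscr{X})\}$. $\mathscr{X}$ is a proximal flow if $P(\mathscr{X})=X\times X$. $S$ is strongly amenable if every minimal proximal flow with phase group $S$ is a singleton. A minimal flow is point distal if $P[x]=\{x\}$ for some $x\in X$. *)

theory Defs
  imports "HOL-Analysis.Analysis"
begin

text \<open>
  The phase group is a type \<open>'s :: topological_group_add\<close>. This class is the library's class of
  topological groups; it is neither commutative nor Hausdorff, only the notation is additive
  (\<open>0\<close> is the identity and \<open>s + t\<close> the product). A flow is a topology together with an action
  on its carrier; phase spaces are nonempty, as usual in topological dynamics.
\<close>

definition flow :: "'a topology \<Rightarrow> ('s::topological_group_add \<Rightarrow> 'a \<Rightarrow> 'a) \<Rightarrow> bool" where
  "flow X act \<longleftrightarrow>
     topspace X \<noteq> {} \<and> compact_space X \<and> Hausdorff_space X \<and>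
     continuous_map (prod_topology euclidean X) X (\<lambda>(t, x). act t x) \<and>
     (\<forall>x\<in>topspace X. act 0 x = x) \<and>
     (\<forall>s t. \<forall>x\<in>topspace X. act (s + t) x = act s (act t x))"

definition trivial_flow :: "'a topology \<Rightarrow> bool" where
  "trivial_flow X \<longleftrightarrow> (\<exists>x. topspace X = {x})"

definition orbit :: "('s \<Rightarrow> 'a \<Rightarrow> 'a) \<Rightarrow> 'a \<Rightarrow> 'a set" where
  "orbit act x = range (\<lambda>t. act t x)"

definition prod_act :: "('s \<Rightarrow> 'a \<Rightarrow> 'a) \<Rightarrow> 's \<Rightarrow> 'a \<times> 'a \<Rightarrow> 'a \<times> 'a" where
  "prod_act act t = (\<lambda>(x, y). (act t x, act t y))"

definition minimal :: "'a topology \<Rightarrow> ('s \<Rightarrow> 'a \<Rightarrow> 'a) \<Rightarrow> bool" where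
  "minimal X act \<longleftrightarrow> (\<forall>x\<in>topspace X. X closure_of orbit act x = topspace X)"

definition topologically_transitive :: "'a topology \<Rightarrow> ('s \<Rightarrow> 'a \<Rightarrow> 'a) \<Rightarrow> bool" where
  "topologically_transitive X act \<longleftrightarrow>
     (\<forall>U. openin X U \<and> U \<noteq> {} \<longrightarrow> X closure_of (\<Union>t. act t ` U) = topspace X)"

definition weakly_mixing :: "'a topology \<Rightarrow> ('s \<Rightarrow> 'a \<Rightarrow> 'a) \<Rightarrow> bool" where
  "weakly_mixing X act \<longleftrightarrow> topologically_transitive (prod_topology X X) (prod_act act)"

definition almost_periodic :: "'a topology \<Rightarrow> ('s \<Rightarrow> 'a \<Rightarrow> 'a) \<Rightarrow> 'a \<Rightarrow> bool" where
  "almost_periodic X act x \<longleftrightarrow> minimal (subtopology X (X closure_of orbit act x)) act"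

definition pointwise_almost_periodic :: "'a topology \<Rightarrow> ('s \<Rightarrow> 'a \<Rightarrow> 'a) \<Rightarrow> bool" where
  "pointwise_almost_periodic X act \<longleftrightarrow> (\<forall>x\<in>topspace X. almost_periodic X act x)"

definition equivariant ::
  "'a topology \<Rightarrow> ('s \<Rightarrow> 'a \<Rightarrow> 'a) \<Rightarrow> ('s \<Rightarrow> 'b \<Rightarrow> 'b) \<Rightarrow> ('a \<Rightarrow> 'b) \<Rightarrow> bool" where
  "equivariant X actX actY f \<longleftrightarrow> (\<forall>t. \<forall>x\<in>topspace X. f (actX t x) = actY t (f x))"

definition extension ::
  "'a topology \<Rightarrow> ('s \<Rightarrow> 'a \<Rightarrow> 'a) \<Rightarrow> 'b topology \<Rightarrow> ('s \<Rightarrow> 'b \<Rightarrow> 'b) \<Rightarrow> ('a \<Rightarrow> 'b) \<Rightarrow> bool" where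
  "extension X actX Y actY f \<longleftrightarrow>
     continuous_map X Y f \<and> f ` topspace X = topspace Y \<and> equivariant X actX actY f"

definition flow_isomorphism ::
  "'a topology \<Rightarrow> ('s \<Rightarrow> 'a \<Rightarrow> 'a) \<Rightarrow> 'b topology \<Rightarrow> ('s \<Rightarrow> 'b \<Rightarrow> 'b) \<Rightarrow> ('a \<Rightarrow> 'b) \<Rightarrow> bool" where
  "flow_isomorphism X actX Y actY f \<longleftrightarrow> homeomorphic_map X Y f \<and> equivariant X actX actY f"

definition directed_set :: "'i set \<Rightarrow> ('i \<times> 'i) set \<Rightarrow> bool" where
  "directed_set L r \<longleftrightarrow>
     L \<noteq> {} \<and> preorder_on L r \<and> (\<forall>i\<in>L. \<forall>j\<in>L. \<exists>k\<in>L. (i, k) \<in> r \<and> (j, k) \<in> r)"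

text \<open>
  The link map \<open>p i j\<close> goes from \<open>Y j\<close> to \<open>Y i\<close> for \<open>(i, j) \<in> r\<close>; as \<open>r\<close> is reflexive, the
  identities \<open>p i i\<close> are counted among the link maps.
\<close>

definition inverse_system_of_flows ::
  "'i set \<Rightarrow> ('i \<times> 'i) set \<Rightarrow> ('i \<Rightarrow> 'b topology) \<Rightarrow> ('i \<Rightarrow> 's::topological_group_add \<Rightarrow> 'b \<Rightarrow> 'b) \<Rightarrow>
    ('i \<Rightarrow> 'i \<Rightarrow> 'b \<Rightarrow> 'b) \<Rightarrow> bool" where
  "inverse_system_of_flows L r Y actY p \<longleftrightarrow>
     directed_set L r \<and>
     (\<forall>i\<in>L. flow (Y i) (actY i)) \<and>
     (\<forall>(i, j)\<in>r. extension (Y j) (actY j) (Y i) (actY i) (p i j)) \<and>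
     (\<forall>i\<in>L. \<forall>y\<in>topspace (Y i). p i i y = y) \<and>
     (\<forall>i j k. (i, j) \<in> r \<and> (j, k) \<in> r \<longrightarrow> (\<forall>y\<in>topspace (Y k). p i k y = p i j (p j k y)))"

definition inverse_limit ::
  "'i set \<Rightarrow> ('i \<times> 'i) set \<Rightarrow> ('i \<Rightarrow> 'b topology) \<Rightarrow> ('i \<Rightarrow> 'i \<Rightarrow> 'b \<Rightarrow> 'b) \<Rightarrow> ('i \<Rightarrow> 'b) topology" where
  "inverse_limit L r Y p =
     subtopology (product_topology Y L) {y. \<forall>(i, j)\<in>r. p i j (y j) = y i}"

definition inverse_limit_act ::
  "'i set \<Rightarrow> ('i \<Rightarrow> 's \<Rightarrow> 'b \<Rightarrow> 'b) \<Rightarrow> 's \<Rightarrow> ('i \<Rightarrow> 'b) \<Rightarrow> ('i \<Rightarrow> 'b)" where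
  "inverse_limit_act L actY t y = (\<lambda>i\<in>L. actY i t (y i))"

text \<open>
  A definition cannot quantify over the types of the indices and of the points of the metrizable
  flows, so these two types are parameters. In a hypothesis with both left as type variables,
  they range over all types. One type for all the metrizable flows is enough: any family of
  spaces can be realised on subsets of a common set.
\<close>

definition quasi_separable ::
  "'i itself \<Rightarrow> 'b itself \<Rightarrow> 'a topology \<Rightarrow> ('s::topological_group_add \<Rightarrow> 'a \<Rightarrow> 'a) \<Rightarrow> bool" where
  "quasi_separable I B X act \<longleftrightarrow>
     (\<exists>(L :: 'i set) r (Y :: 'i \<Rightarrow> 'b topology) actY p f.
        inverse_system_of_flows L r Y actY p \<and>
        (\<forall>i\<in>L. metrizable_space (Y i)) \<and>
        flow_isomorphism X act (inverse_limit L r Y p) (inverse_limit_act L actY) f)"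

definition proximal_relation :: "'a topology \<Rightarrow> ('s \<Rightarrow> 'a \<Rightarrow> 'a) \<Rightarrow> ('a \<times> 'a) set" where
  "proximal_relation X act =
     {(x, x') \<in> topspace X \<times> topspace X.
        (prod_topology X X closure_of orbit (prod_act act) (x, x')) \<inter> Id_on (topspace X) \<noteq> {}}"

definition proximal_cell :: "'a topology \<Rightarrow> ('s \<Rightarrow> 'a \<Rightarrow> 'a) \<Rightarrow> 'a \<Rightarrow> 'a set" where
  "proximal_cell X act x = {x' \<in> topspace X. (x, x') \<in> proximal_relation X act}"

definition proximal :: "'a topology \<Rightarrow> ('s \<Rightarrow> 'a \<Rightarrow> 'a) \<Rightarrow> bool" where
  "proximal X act \<longleftrightarrow> proximal_relation X act = topspace X \<times> topspace X"

definition point_distal :: "'a topology \<Rightarrow> ('s \<Rightarrow> 'a \<Rightarrow> 'a) \<Rightarrow> bool" where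
  "point_distal X act \<longleftrightarrow> minimal X act \<and> (\<exists>x\<in>topspace X. proximal_cell X act x = {x})"

text \<open>
  The minimal proximal flows are taken on carriers in \<open>'s set set\<close>. This is no restriction: the
  points of a minimal flow are separated by the traces of their neighbourhoods on one orbit, so
  every minimal flow, on a carrier of any type, is isomorphic to one of these. Lemma
  \<open>strongly_amenable_imp_trivial_flow\<close> gives the statement for carriers of all types.
\<close>

definition strongly_amenable :: "'s::topological_group_add itself \<Rightarrow> bool" where
  "strongly_amenable S \<longleftrightarrow>
     (\<forall>(X :: 's set set topology) (act :: 's \<Rightarrow> 's set set \<Rightarrow> 's set set).
        flow X act \<and> minimal X act \<and> proximal X act \<longrightarrow> trivial_flow X)"

lemma strongly_amenable_imp_trivial_flow:
  fixes X :: "'a topology" and act :: "'s::topological_group_add \<Rightarrow> 'a \<Rightarrow> 'a"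
  assumes "strongly_amenable TYPE('s)" and "flow X act" and "minimal X act" and "proximal X act"
  shows "trivial_flow X"
proof -
  obtain x0 where x0: "x0 \<in> topspace X"
    using assms(2) unfolding flow_def by blast
  have cm: "continuous_map (prod_topology euclidean X) X (\<lambda>(t, x). act t x)"
    and act0: "\<And>x. x \<in> topspace X \<Longrightarrow> act 0 x = x"
    and actp: "\<And>s t x. x \<in> topspace X \<Longrightarrow> act (s + t) x = act s (act t x)"
    and cpt: "compact_space X" and haus: "Hausdorff_space X"
    using assms(2) by (auto simp: flow_def)
  have inX: "act t x \<in> topspace X" if "x \<in> topspace X" for t x
    using continuous_map_image_subset_topspace[OF cm] that by (auto simp: topspace_prod_topology)
  have dense: "X closure_of orbit act x0 = topspace X"
    using assms(3) x0 by (auto simp: minimal_def)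
  define e where "e y = {{t. act t x0 \<in> U} |U. openin X U \<and> y \<in> U}" for y
  have inj: "inj_on e (topspace X)"
  proof (rule inj_onI, rule ccontr)
    fix y z assume y: "y \<in> topspace X" and z: "z \<in> topspace X" and eq: "e y = e z" and "y \<noteq> z"
    then obtain U V where U: "openin X U" "y \<in> U" and V: "openin X V" "z \<in> V" and "disjnt U V"
      using haus unfolding Hausdorff_space_def by metis
    have "{t. act t x0 \<in> U} \<in> e y"
      unfolding e_def using U by (intro CollectI exI[of _ U] conjI refl)
    then have "\<exists>W. {t. act t x0 \<in> U} = {t. act t x0 \<in> W} \<and> openin X W \<and> z \<in> W"
      unfolding eq unfolding e_def by (rule CollectD)
    then obtain W where W: "openin X W" "z \<in> W" "{t. act t x0 \<in> U} = {t. act t x0 \<in> W}"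
      by (elim exE conjE)
    have "z \<in> X closure_of orbit act x0"
      using dense z by simp
    then have "\<exists>w\<in>orbit act x0. w \<in> V \<inter> W"
      using W(2) V(2) openin_Int[OF V(1) W(1)] unfolding in_closure_of by (metis IntI)
    then obtain t where "act t x0 \<in> V" "act t x0 \<in> W"
      by (auto simp: orbit_def)
    then show False
      using W(3) \<open>disjnt U V\<close> unfolding disjnt_iff by (metis mem_Collect_eq)
  qed
  define g where "g = inv_into (topspace X) e"
  have ge: "g (e y) = y" if "y \<in> topspace X" for y
    using inj that by (simp add: g_def)
  define Y where "Y = pullback_topology (e ` topspace X) g X"
  have topY: "topspace Y = e ` topspace X"
    using ge by (auto simp: Y_def topspace_pullback_topology)
  have cg: "continuous_map Y X g"
    using continuous_map_pullback[OF continuous_map_id, of "e ` topspace X" g X]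
    by (simp add: Y_def)
  have ce: "continuous_map X Y e"
    unfolding Y_def
  proof (rule continuous_map_pullback')
    show "continuous_map X X (g \<circ> e)"
      by (rule continuous_map_eq[OF continuous_map_id]) (auto simp: ge)
  qed auto
  have "homeomorphic_maps X Y e g"
    using ce cg ge topY by (auto simp: homeomorphic_maps_def)
  then have hs: "X homeomorphic_space Y"
    by (auto simp: homeomorphic_space_def)
  define b where "b t y = e (act t (g y))" for t y
  have be: "b t (e y) = e (act t y)" if "y \<in> topspace X" for t y
    using that by (simp add: b_def ge)
  have "continuous_map (prod_topology euclidean Y) Y (e \<circ> ((\<lambda>(t, x). act t x) \<circ> (\<lambda>(t, y). (t, g y))))"
  proof (intro continuous_map_compose[OF _ ce] continuous_map_compose[OF _ cm])
    show "continuous_map (prod_topology euclidean Y) (prod_topology euclidean X) (\<lambda>(t, y). (t, g y))"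
      using cg by (simp add: continuous_map_prod_top[where f = "\<lambda>t. t"])
  qed
  then have cb: "continuous_map (prod_topology euclidean Y) Y (\<lambda>(t, y). b t y)"
    by (rule continuous_map_eq) (auto simp: b_def)
  have "flow Y b"
    unfolding flow_def
    using x0 topY cb homeomorphic_compact_space[OF hs] homeomorphic_Hausdorff_space[OF hs] cpt haus
    by (auto simp: be act0 actp inX)
  moreover have "minimal Y b"
    unfolding minimal_def
  proof
    fix y assume "y \<in> topspace Y"
    then obtain x where x: "x \<in> topspace X" "y = e x"
      using topY by auto
    have "e ` topspace X \<subseteq> Y closure_of (e ` orbit act x)"
      using continuous_map_image_closure_subset[OF ce, of "orbit act x"] assms(3) x
      by (simp add: minimal_def)
    moreover have "e ` orbit act x = orbit b y"
      using x be by (auto simp: orbit_def image_image)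
    ultimately show "Y closure_of orbit b y = topspace Y"
      using topY by (metis closure_of_subset_topspace subset_antisym)
  qed
  moreover have "proximal Y b"
  proof -
    have "(e x, e x') \<in> proximal_relation Y b" if x: "x \<in> topspace X" "x' \<in> topspace X" for x x'
    proof -
      define E where "E = (\<lambda>(u, v). (e u, e v))"
      have cE: "continuous_map (prod_topology X X) (prod_topology Y Y) E"
        using ce by (simp add: E_def continuous_map_prod_top)
      have "(x, x') \<in> proximal_relation X act"
        using assms(4) x by (auto simp: proximal_def)
      then obtain p where p: "p \<in> topspace X"
          "(p, p) \<in> prod_topology X X closure_of orbit (prod_act act) (x, x')"
        by (auto simp: proximal_relation_def Id_on_def)
      have "E (p, p) \<in> prod_topology Y Y closure_of (E ` orbit (prod_act act) (x, x'))"
        using continuous_map_image_closure_subset[OF cE] p(2) by blast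
      moreover have "E ` orbit (prod_act act) (x, x') = orbit (prod_act b) (e x, e x')"
        using x by (auto simp: orbit_def image_image E_def prod_act_def be)
      ultimately show ?thesis
        using p(1) x topY by (auto simp: proximal_relation_def Id_on_def E_def)
    qed
    then show ?thesis
      unfolding proximal_def using topY by (auto simp: proximal_relation_def)
  qed
  ultimately have "trivial_flow Y"
    using assms(1) by (auto simp: strongly_amenable_def)
  then obtain c where "e ` topspace X = {c}"
    using topY by (auto simp: trivial_flow_def)
  then have "x = x0" if "x \<in> topspace X" for x
    using inj x0 that by (metis imageI inj_onD singletonD)
  then have "topspace X = {x0}"
    using x0 by blast
  then show ?thesis
    by (auto simp: trivial_flow_def)
qed

end

theory Submission
  imports Defs
begin

text \<open>
  The main step concerns a minimal, weakly mixing, metrizable flow \<open>Y\<close> of a strongly amenable group: all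
  its proximal cells are residual. A strongly amenable group leaves a mean on the continuous functions
  of \<open>Y\<close> invariant, because a minimal closed convex invariant set of means is a proximal flow
  (\<open>strongly_amenable_imp_invariant_mean\<close>). Given an open neighbourhood \<open>D\<close> of the diagonal, let \<open>W\<close> be the
  closed set of pairs whose orbit never enters \<open>D\<close>. With respect to the invariant mean, the measure of the
  symmetric difference of two sections of \<open>W\<close> is an invariant pseudometric on \<open>Y\<close>, which weak mixing forces
  to vanish (\<open>open_in_one_section_imp_all\<close>). So an open set inside one section lies in all of them, which is
  absurd because \<open>W\<close> misses the diagonal. Every section of \<open>W\<close> thus has empty interior, for every point
  and not merely for generic ones, and Baire's theorem, applied to a countable family of such \<open>D\<close>, shows
  that each proximal cell is dense and that any two cells meet (\<open>proximal_cells\<close>).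

  If proximality were transitive on \<open>Y\<close>, then since any two cells meet, all pairs would be proximal and
  strong amenability would make \<open>Y\<close> a point. If one cell were closed, it would be all of \<open>Y\<close>; then
  too all pairs are proximal (\<open>proximal_if_full_cell\<close>), with the same conclusion.

  The given flow \<open>X\<close> is reduced to this case by a factor. A nontrivial quasi-separable flow has a nontrivial
  metrizable factor \<open>Y\<close> (\<open>quasi_separable_metrizable_factor\<close>), which inherits weak mixing and pointwise almost
  periodicity. By Baire's theorem \<open>Y\<close> has a point with dense orbit; as this point is almost periodic,
  \<open>Y\<close> is minimal. Transitivity of proximality and closedness of a cell go down from \<open>X\<close> to \<open>Y\<close>, because
  proximal pairs of a minimal factor can be lifted with one point prescribed (\<open>proximal_lift\<close>); this is the
  place where idempotents of the enveloping semigroup come in.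
\<close>

section \<open>Minimal closed sets in compact spaces\<close>

text \<open>
  Compactness makes the intersection of a chain of nonempty closed sets nonempty, so Zorn's lemma
  applies to every property that survives intersections. It is used for invariant sets (minimal
  flows), for subsemigroups (idempotents) and for invariant convex sets of means.
\<close>

lemma compact_minimal_closedin:
  assumes X: "compact_space X" and A: "closedin X A" "A \<noteq> {}" "P A"
    and Inter: "\<And>\<B>. \<B> \<noteq> {} \<Longrightarrow> (\<And>B. B \<in> \<B> \<Longrightarrow> P B) \<Longrightarrow> P (\<Inter>\<B>)"
  obtains M where "closedin X M" "M \<noteq> {}" "P M" "M \<subseteq> A"
    "\<And>B. closedin X B \<Longrightarrow> B \<noteq> {} \<Longrightarrow> P B \<Longrightarrow> B \<subseteq> M \<Longrightarrow> B = M"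
proof -
  define \<A> where "\<A> = {B. closedin X B \<and> B \<noteq> {} \<and> P B \<and> B \<subseteq> A}"
  have "\<exists>M\<in>\<A>. \<forall>B\<in>\<A>. B \<subseteq> M \<longrightarrow> B = M"
  proof (rule predicate_Zorn[where P = "\<lambda>B C. C \<subseteq> B", simplified])
    show "partial_order_on \<A> (relation_of (\<lambda>B C. C \<subseteq> B) \<A>)"
      by (rule partial_order_on_relation_ofI) auto
  next
    fix \<C> assume chain: "\<C> \<in> Chains (relation_of (\<lambda>B C. C \<subseteq> B) \<A>)"
    then have sub: "\<C> \<subseteq> \<A>"
      by (rule Chains_relation_of)
    show "\<exists>U\<in>\<A>. \<forall>B\<in>\<C>. U \<subseteq> B"
    proof (cases "\<C> = {}")
      case True
      then show ?thesis
        using A by (auto simp: \<A>_def)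
    next
      case False
      have cmp: "B \<subseteq> C \<or> C \<subseteq> B" if "B \<in> \<C>" "C \<in> \<C>" for B C
        using chain that by (auto simp: Chains_def relation_of_def)
      have "\<Inter>\<F> \<noteq> {}" if \<F>: "finite \<F>" "\<F> \<subseteq> \<C>" for \<F>
      proof (cases "\<F> = {}")
        case False
        have "subset.chain \<C> \<F>"
          using cmp \<F>(2) by (auto simp: subset_chain_def)
        then have "\<Inter>\<F> \<in> \<F>"
          using Inter_in_chain[OF \<F>(1) False] by blast
        then show ?thesis
          using \<F>(2) sub by (auto simp: \<A>_def)
      qed simp
      moreover have "\<forall>C\<in>\<C>. closedin X C"
        using sub by (auto simp: \<A>_def)
      ultimately have ne: "\<Inter>\<C> \<noteq> {}"
        using X unfolding compact_space_fip by simp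
      have "closedin X (\<Inter>\<C>)"
        using False sub by (intro closedin_Inter) (auto simp: \<A>_def)
      moreover have "P (\<Inter>\<C>)"
        using False sub by (intro Inter) (auto simp: \<A>_def)
      moreover have "\<Inter>\<C> \<subseteq> A"
        using False sub by (auto simp: \<A>_def)
      ultimately have "\<Inter>\<C> \<in> \<A>"
        using ne by (simp add: \<A>_def)
      then show ?thesis
        by (intro bexI[of _ "\<Inter>\<C>"]) auto
    qed
  qed
  then obtain M where M: "M \<in> \<A>" "\<And>B. B \<in> \<A> \<Longrightarrow> B \<subseteq> M \<Longrightarrow> B = M"
    by auto
  then have "B = M" if "closedin X B" "B \<noteq> {}" "P B" "B \<subseteq> M" for B
    using that by (auto simp: \<A>_def)
  with M(1) show ?thesis
    by (intro that[of M]) (auto simp: \<A>_def)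
qed

section \<open>Flows, subflows and products\<close>

lemma flowD:
  assumes "flow X act"
  shows flow_nonempty: "topspace X \<noteq> {}" and flow_compact: "compact_space X"
    and flow_Hausdorff: "Hausdorff_space X"
    and flow_continuous: "continuous_map (prod_topology euclidean X) X (\<lambda>(t, x). act t x)"
    and flow_zero: "\<And>x. x \<in> topspace X \<Longrightarrow> act 0 x = x"
    and flow_add: "\<And>s t x. x \<in> topspace X \<Longrightarrow> act (s + t) x = act s (act t x)"
  using assms by (auto simp: flow_def)

lemma flow_in_topspace:
  assumes "flow X act" "x \<in> topspace X"
  shows "act t x \<in> topspace X"
  using continuous_map_image_subset_topspace[OF flow_continuous[OF assms(1)]] assms(2)
  by auto

lemma flow_inverse:
  assumes "flow X act" "x \<in> topspace X"
  shows "act (- t) (act t x) = x" "act t (act (- t) x) = x"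
  using flow_add[OF assms(1,2), of "- t" t] flow_add[OF assms(1,2), of t "- t"]
    flow_zero[OF assms] by auto

lemma flow_continuous_act:
  assumes "flow X act"
  shows "continuous_map X X (act t)"
proof -
  have "continuous_map X (prod_topology euclidean X) (\<lambda>x. (t, x))"
    by (simp add: continuous_map_pairwise o_def)
  from continuous_map_compose[OF this flow_continuous[OF assms]] show ?thesis
    by (simp add: o_def)
qed

lemma orbit_subset: "flow X act \<Longrightarrow> x \<in> topspace X \<Longrightarrow> orbit act x \<subseteq> topspace X"
  by (auto simp: orbit_def flow_in_topspace)

lemma in_orbit_closure:
  assumes "flow X act" "x \<in> topspace X"
  shows "x \<in> X closure_of orbit act x"
proof -
  have "act 0 x \<in> orbit act x"
    by (auto simp: orbit_def)
  then show ?thesis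
    using closure_of_subset[OF orbit_subset[OF assms]] flow_zero[OF assms] by auto
qed

lemma orbit_closure_least:
  assumes "flow X act" "closedin X C" "x \<in> C" "\<And>t y. y \<in> C \<Longrightarrow> act t y \<in> C"
  shows "X closure_of orbit act x \<subseteq> C"
  using assms by (intro closure_of_minimal) (auto simp: orbit_def)

lemma orbit_closure_invariant:
  assumes f: "flow X act" and x: "x \<in> topspace X" and y: "y \<in> X closure_of orbit act x"
  shows "act t y \<in> X closure_of orbit act x"
proof -
  have "act t ` (X closure_of orbit act x) \<subseteq> X closure_of (act t ` orbit act x)"
    by (rule continuous_map_image_closure_subset[OF flow_continuous_act[OF f]])
  moreover have "act t ` orbit act x \<subseteq> orbit act x"
    by (auto simp: orbit_def flow_add[OF f x, symmetric])
  ultimately show ?thesis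
    using y closure_of_mono by blast
qed

lemma orbit_closure_trans:
  assumes "flow X act" "x \<in> topspace X" "y \<in> X closure_of orbit act x"
  shows "X closure_of orbit act y \<subseteq> X closure_of orbit act x"
  using assms by (intro orbit_closure_least) (auto intro: orbit_closure_invariant)

lemma flow_subflow:
  assumes f: "flow X act" and C: "closedin X C" "C \<noteq> {}" "\<And>t y. y \<in> C \<Longrightarrow> act t y \<in> C"
  shows "flow (subtopology X C) act"
proof -
  have sub: "C \<subseteq> topspace X"
    using C(1) by (rule closedin_subset)
  have "continuous_map (prod_topology euclidean (subtopology X C)) X (\<lambda>(t, x). act t x)"
    using continuous_map_from_subtopology[OF flow_continuous[OF f]]
    by (simp add: prod_topology_subtopology)
  then have "continuous_map (prod_topology euclidean (subtopology X C)) (subtopology X C) (\<lambda>(t, x). act t x)"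
    using C(3) by (auto simp: continuous_map_in_subtopology)
  then show ?thesis
    using f C sub
    by (auto simp: flow_def Hausdorff_space_subtopology subset_iff Int_absorb1
        intro: closedin_compact_space compact_space_subtopology)
qed

lemma minimal_iff_closed_invariant:
  assumes f: "flow X act"
  shows "minimal X act \<longleftrightarrow>
    (\<forall>C. closedin X C \<and> C \<noteq> {} \<and> (\<forall>t. \<forall>y\<in>C. act t y \<in> C) \<longrightarrow> C = topspace X)"
    (is "_ \<longleftrightarrow> ?R")
proof
  assume m: "minimal X act"
  show ?R
  proof (intro allI impI, elim conjE)
    fix C assume C: "closedin X C" "C \<noteq> {}" "\<forall>t. \<forall>y\<in>C. act t y \<in> C"
    then obtain x where "x \<in> C" "x \<in> topspace X"
      using closedin_subset by blast
    then show "C = topspace X"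
      using m orbit_closure_least[OF f C(1), of x] C closedin_subset by (force simp: minimal_def)
  qed
next
  assume R: ?R
  show "minimal X act"
    unfolding minimal_def
  proof
    fix x assume x: "x \<in> topspace X"
    show "X closure_of orbit act x = topspace X"
      using R in_orbit_closure[OF f x] orbit_closure_invariant[OF f x] by (metis closedin_closure_of empty_iff)
  qed
qed

text \<open>
  The complement is closed and invariant, because the inverse of a translation is a translation.
\<close>

lemma minimal_open_invariant:
  assumes f: "flow X act" and "minimal X act" and U: "openin X U" "U \<noteq> {}"
    and inv: "\<And>t x. x \<in> U \<Longrightarrow> act t x \<in> U"
  shows "U = topspace X"
proof -
  have out: "act t y \<notin> U" if "y \<in> topspace X" "y \<notin> U" for t y
    using inv[of "act t y" "- t"] flow_inverse[OF f that(1)] that(2) by auto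
  have "closedin X (topspace X - U)"
    using U(1) by blast
  moreover have "\<forall>t. \<forall>y\<in>topspace X - U. act t y \<in> topspace X - U"
    using out flow_in_topspace[OF f] by blast
  ultimately have "topspace X - U = {} \<or> topspace X - U = topspace X"
    using assms(2) unfolding minimal_iff_closed_invariant[OF f] by blast
  then show ?thesis
    using U openin_subset by blast
qed

lemma minimal_subflow_exists:
  assumes f: "flow X act" and C: "closedin X C" "C \<noteq> {}" "\<And>t y. y \<in> C \<Longrightarrow> act t y \<in> C"
  obtains M where "closedin X M" "M \<noteq> {}" "M \<subseteq> C" "\<And>t y. y \<in> M \<Longrightarrow> act t y \<in> M"
    "flow (subtopology X M) act" "minimal (subtopology X M) act"
proof -
  obtain M where M: "closedin X M" "M \<noteq> {}" "\<forall>t. \<forall>y\<in>M. act t y \<in> M" "M \<subseteq> C"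
    and min: "\<And>B. closedin X B \<Longrightarrow> B \<noteq> {} \<Longrightarrow> \<forall>t. \<forall>y\<in>B. act t y \<in> B \<Longrightarrow> B \<subseteq> M \<Longrightarrow> B = M"
  proof (rule compact_minimal_closedin[OF flow_compact[OF f] C(1,2)])
    show "\<forall>t. \<forall>y\<in>C. act t y \<in> C"
      using C(3) by blast
    show "\<forall>t. \<forall>y\<in>\<Inter>\<B>. act t y \<in> \<Inter>\<B>" if "\<And>B. B \<in> \<B> \<Longrightarrow> \<forall>t. \<forall>y\<in>B. act t y \<in> B" for \<B>
      using that by blast
  qed blast
  have fM: "flow (subtopology X M) act"
    using M by (intro flow_subflow[OF f]) auto
  have top: "topspace (subtopology X M) = M"
    using closedin_subset[OF M(1)] by (rule topspace_subtopology_subset)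
  have "minimal (subtopology X M) act"
    unfolding minimal_iff_closed_invariant[OF fM] top
  proof (intro allI impI, elim conjE)
    fix B assume B: "closedin (subtopology X M) B" "B \<noteq> {}" "\<forall>t. \<forall>y\<in>B. act t y \<in> B"
    then show "B = M"
      using min closedin_trans_full[OF B(1) M(1)] closedin_subset[OF B(1)] top by blast
  qed
  then show ?thesis
    using that M fM by blast
qed

lemma flow_prod:
  fixes X :: "'a topology" and Y :: "'b topology" and a :: "'c::topological_group_add \<Rightarrow> 'a \<Rightarrow> 'a"
  assumes f: "flow X a" and g: "flow Y b"
  shows "flow (prod_topology X Y) (\<lambda>t. map_prod (a t) (b t))"
proof -
  let ?T = "prod_topology euclidean (prod_topology X Y) :: ('c \<times> 'a \<times> 'b) topology"
  have 1: "continuous_map ?T X (fst \<circ> snd)" 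
    by (rule continuous_map_compose[OF continuous_map_snd continuous_map_fst])
  have 2: "continuous_map ?T Y (snd \<circ> snd)"
    by (rule continuous_map_compose[OF continuous_map_snd continuous_map_snd])
  have 3: "continuous_map ?T (prod_topology euclidean X) (\<lambda>p. (fst p, fst (snd p)))"
    using 1 continuous_map_fst[of euclidean "prod_topology X Y"] by (simp add: continuous_map_pairwise o_def)
  have 4: "continuous_map ?T (prod_topology euclidean Y) (\<lambda>p. (fst p, snd (snd p)))"
    using 2 continuous_map_fst[of euclidean "prod_topology X Y"] by (simp add: continuous_map_pairwise o_def)
  have 5: "continuous_map ?T X ((\<lambda>(t, x). a t x) \<circ> (\<lambda>p. (fst p, fst (snd p))))"
    by (rule continuous_map_compose[OF 3 flow_continuous[OF f]])
  have 6: "continuous_map ?T Y ((\<lambda>(t, x). b t x) \<circ> (\<lambda>p. (fst p, snd (snd p))))"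
    by (rule continuous_map_compose[OF 4 flow_continuous[OF g]])
  have "continuous_map ?T (prod_topology X Y) (\<lambda>(t, x). map_prod (a t) (b t) x)"
    using 5 6 by (simp add: continuous_map_pairwise o_def case_prod_unfold map_prod_def)
  then show ?thesis
    using f g by (auto simp: flow_def compact_space_prod_topology Hausdorff_space_prod_topology)
qed

lemma prod_act_map_prod: "prod_act act = (\<lambda>t. map_prod (act t) (act t))"
  by (auto simp: prod_act_def fun_eq_iff)

lemma flow_prod_act: "flow X act \<Longrightarrow> flow (prod_topology X X) (prod_act act)"
  unfolding prod_act_map_prod by (rule flow_prod)

text \<open>
  If an orbit closure in the product misses the diagonal, its complement is a neighbourhood of the
  diagonal that the orbit never enters.
\<close>

lemma proximal_iff_neighbourhoods:
  assumes f: "flow X act" and x: "x \<in> topspace X" "y \<in> topspace X"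
  shows "(x, y) \<in> proximal_relation X act \<longleftrightarrow>
    (\<forall>W. openin (prod_topology X X) W \<and> (\<forall>z\<in>topspace X. (z, z) \<in> W) \<longrightarrow> (\<exists>t. (act t x, act t y) \<in> W))"
    (is "_ \<longleftrightarrow> ?R")
proof
  assume "(x, y) \<in> proximal_relation X act"
  then obtain z where "z \<in> topspace X" "(z, z) \<in> prod_topology X X closure_of orbit (prod_act act) (x, y)"
    by (auto simp: proximal_relation_def Id_on_def)
  then show ?R
    by (auto simp: in_closure_of orbit_def prod_act_def)
next
  assume R: ?R
  define K where "K = prod_topology X X closure_of orbit (prod_act act) (x, y)"
  have sub: "orbit (prod_act act) (x, y) \<subseteq> K"
    unfolding K_def using orbit_subset[OF flow_prod_act[OF f], of "(x, y)"] x
    by (intro closure_of_subset) auto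
  have "openin (prod_topology X X) (topspace (prod_topology X X) - K)"
    unfolding K_def by (intro openin_diff openin_topspace closedin_closure_of)
  moreover have "\<nexists>t. (act t x, act t y) \<in> topspace (prod_topology X X) - K"
    using sub by (auto simp: orbit_def prod_act_def)
  ultimately obtain z where "z \<in> topspace X" "(z, z) \<in> K"
    using R by fastforce
  then show "(x, y) \<in> proximal_relation X act"
    using x by (auto simp: proximal_relation_def K_def Id_on_def)
qed

lemma proximal_relation_subset: "proximal_relation X act \<subseteq> topspace X \<times> topspace X"
  by (auto simp: proximal_relation_def)

lemma proximal_sym:
  assumes f: "flow X act" and p: "(x, y) \<in> proximal_relation X act"
  shows "(y, x) \<in> proximal_relation X act"
proof -
  have x: "x \<in> topspace X" "y \<in> topspace X"
    using p proximal_relation_subset by blast+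
  have "\<exists>t. (act t y, act t x) \<in> W"
    if W: "openin (prod_topology X X) W" "\<forall>z\<in>topspace X. (z, z) \<in> W" for W
  proof -
    define W' where "W' = {p \<in> topspace (prod_topology X X). (snd p, fst p) \<in> W}"
    have "continuous_map (prod_topology X X) (prod_topology X X) (\<lambda>p. (snd p, fst p))"
      by (simp add: continuous_map_pairwise o_def continuous_map_fst continuous_map_snd)
    then have "openin (prod_topology X X) W'"
      unfolding W'_def using W(1) by (rule openin_continuous_map_preimage)
    moreover have "\<forall>z\<in>topspace X. (z, z) \<in> W'"
      using W(2) by (auto simp: W'_def)
    ultimately show ?thesis
      using p[unfolded proximal_iff_neighbourhoods[OF f x]] by (fastforce simp: W'_def)
  qed
  then show ?thesis
    using proximal_iff_neighbourhoods[OF f x(2,1)] by blast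
qed

text \<open>
  A subflow is closed, so orbit closures computed in it and in the whole flow coincide; proximality
  of two points therefore does not depend on the ambient flow.
\<close>

lemma proximal_subflow:
  assumes f: "flow X a" and fC: "flow (subtopology X C) a" and C: "closedin X C"
  shows "proximal_relation (subtopology X C) a = proximal_relation X a \<inter> C \<times> C"
proof -
  have top: "topspace (subtopology X C) = C"
    using closedin_subset[OF C] by (rule topspace_subtopology_subset)
  have "((prod_topology (subtopology X C) (subtopology X C)) closure_of orbit (prod_act a) (x, y)) \<inter> Id_on C =
    (prod_topology X X closure_of orbit (prod_act a) (x, y)) \<inter> Id_on (topspace X)"
    if xy: "x \<in> C" "y \<in> C" for x y
  proof -
    have orb: "orbit (prod_act a) (x, y) \<subseteq> C \<times> C"
      using flow_in_topspace[OF fC] xy unfolding top by (auto simp: orbit_def prod_act_def)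
    have "prod_topology X X closure_of orbit (prod_act a) (x, y) \<subseteq> C \<times> C"
      using orb C by (intro closure_of_minimal) (auto simp: closedin_prod_Times_iff)
    moreover have "(prod_topology (subtopology X C) (subtopology X C)) closure_of orbit (prod_act a) (x, y) =
      C \<times> C \<inter> (prod_topology X X closure_of orbit (prod_act a) (x, y))"
      using orb by (simp add: closure_of_subtopology Int_absorb1 flip: subtopology_Times)
    ultimately show ?thesis
      using closedin_subset[OF C] by (auto simp: Id_on_def)
  qed
  then show ?thesis
    using closedin_subset[OF C] unfolding proximal_relation_def top by fastforce
qed

section \<open>Factors\<close>

lemma extension_continuous: "extension X a Y b f \<Longrightarrow> continuous_map X Y f"
  and extension_surj: "extension X a Y b f \<Longrightarrow> f ` topspace X = topspace Y"
  and extension_act: "extension X a Y b f \<Longrightarrow> x \<in> topspace X \<Longrightarrow> f (a t x) = b t (f x)"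
  by (auto simp: extension_def equivariant_def)

lemma extension_orbit:
  assumes "extension X a Y b f" "x \<in> topspace X"
  shows "f ` orbit a x = orbit b (f x)"
  using assms by (auto simp: orbit_def image_image extension_act)

text \<open>
  A continuous map from a compact space to a Hausdorff space is closed. This is what makes the image
  of an orbit closure an orbit closure and, further on, the image of a closed proximal cell closed.
\<close>

lemma extension_closed_image:
  assumes "flow X a" "flow Y b" "extension X a Y b f" "closedin X C"
  shows "closedin Y (f ` C)"
  using continuous_imp_closed_map[OF extension_continuous[OF assms(3)] flow_compact[OF assms(1)] flow_Hausdorff[OF assms(2)]] assms(4)
  by (simp add: closed_map_def)

lemma extension_orbit_closure:
  assumes X: "flow X a" and Y: "flow Y b" and f: "extension X a Y b f" and x: "x \<in> topspace X"
  shows "f ` (X closure_of orbit a x) = Y closure_of orbit b (f x)"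
proof
  show "f ` (X closure_of orbit a x) \<subseteq> Y closure_of orbit b (f x)"
    using continuous_map_image_closure_subset[OF extension_continuous[OF f]] extension_orbit[OF f x] by metis
  show "Y closure_of orbit b (f x) \<subseteq> f ` (X closure_of orbit a x)"
    using closure_of_subset[OF orbit_subset[OF X x]]
    by (intro closure_of_minimal extension_closed_image[OF X Y f])
       (auto simp flip: extension_orbit[OF f x])
qed

lemma extension_prod_act:
  assumes "extension X a Y b f"
  shows "extension (prod_topology X X) (prod_act a) (prod_topology Y Y) (prod_act b) (map_prod f f)"
proof -
  have "map_prod f f ` (topspace X \<times> topspace X) = topspace Y \<times> topspace Y"
    using map_prod_surj_on extension_surj[OF assms] by blast
  moreover have "continuous_map (prod_topology X X) (prod_topology Y Y) (map_prod f f)"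
    using extension_continuous[OF assms] by (simp add: map_prod_def continuous_map_prod_top)
  ultimately show ?thesis
    using assms by (auto simp: extension_def equivariant_def prod_act_def)
qed

lemma topologically_transitive_factor:
  assumes f: "extension X a Y b f" and tr: "topologically_transitive X a"
  shows "topologically_transitive Y b"
  unfolding topologically_transitive_def
proof (intro allI impI, elim conjE)
  fix U assume U: "openin Y U" "U \<noteq> {}"
  define V where "V = {x \<in> topspace X. f x \<in> U}"
  have V: "openin X V"
    unfolding V_def by (rule openin_continuous_map_preimage[OF extension_continuous[OF f] U(1)])
  obtain y where y: "y \<in> U"
    using U(2) by blast
  then obtain x where "x \<in> topspace X" "y = f x"
    using openin_subset[OF U(1)] extension_surj[OF f] by blast
  then have "V \<noteq> {}"
    using y by (auto simp: V_def)
  then have dense: "X closure_of (\<Union>t. a t ` V) = topspace X"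
    using tr V by (auto simp: topologically_transitive_def)
  have "f ` (\<Union>t. a t ` V) \<subseteq> (\<Union>t. b t ` U)"
    by (auto simp: V_def extension_act[OF f])
  then have "Y closure_of (f ` (\<Union>t. a t ` V)) \<subseteq> Y closure_of (\<Union>t. b t ` U)"
    by (rule closure_of_mono)
  moreover have "f ` topspace X \<subseteq> Y closure_of (f ` (\<Union>t. a t ` V))"
    using continuous_map_image_closure_subset[OF extension_continuous[OF f], of "\<Union>t. a t ` V"] dense by simp
  ultimately show "Y closure_of (\<Union>t. b t ` U) = topspace Y"
    using extension_surj[OF f] closure_of_subset_topspace[of Y] by blast
qed

lemma weakly_mixing_factor:
  assumes "extension X a Y b f" "weakly_mixing X a"
  shows "weakly_mixing Y b"
  using assms topologically_transitive_factor[OF extension_prod_act] by (auto simp: weakly_mixing_def)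

lemma weakly_mixing_imp_transitive:
  assumes "weakly_mixing X a"
  shows "topologically_transitive X a"
  unfolding topologically_transitive_def
proof (intro allI impI, elim conjE)
  fix U assume U: "openin X U" "U \<noteq> {}"
  then have "openin (prod_topology X X) (U \<times> U)" "U \<times> U \<noteq> {}"
    by (auto simp: openin_prod_Times_iff)
  then have dense: "prod_topology X X closure_of (\<Union>t. prod_act a t ` (U \<times> U)) = topspace X \<times> topspace X"
    using assms by (simp add: weakly_mixing_def topologically_transitive_def)
  have "fst ` (topspace X \<times> topspace X) \<subseteq> X closure_of (fst ` (\<Union>t. prod_act a t ` (U \<times> U)))"
    using continuous_map_image_closure_subset[OF continuous_map_fst, of X X] dense by metis
  also have "\<dots> \<subseteq> X closure_of (\<Union>t. a t ` U)"
    by (intro closure_of_mono) (auto simp: prod_act_def)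
  finally show "X closure_of (\<Union>t. a t ` U) = topspace X"
    using closure_of_subset_topspace[of X] by force
qed

text \<open>
  Minimality of an orbit closure, written as a symmetry of the relation of lying in the orbit closure;
  in this form it is visibly inherited by factors.
\<close>

lemma almost_periodic_iff:
  assumes f: "flow X a" and x: "x \<in> topspace X"
  shows "almost_periodic X a x \<longleftrightarrow> (\<forall>y \<in> X closure_of orbit a x. x \<in> X closure_of orbit a y)"
proof -
  define K where "K = X closure_of orbit a x"
  have K: "K \<subseteq> topspace X" "topspace (subtopology X K) = K"
    unfolding K_def using closure_of_subset_topspace[of X] by (auto intro!: topspace_subtopology_subset)
  have sub: "X closure_of orbit a y \<subseteq> K" if "y \<in> K" for y
    using orbit_closure_trans[OF f x] that by (simp add: K_def)
  have "orbit a y \<subseteq> K" if "y \<in> K" for y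
    using orbit_closure_invariant[OF f x] that by (auto simp: K_def orbit_def)
  then have "subtopology X K closure_of orbit a y = X closure_of orbit a y" if "y \<in> K" for y
    using that sub[OF that] by (simp add: closure_of_subtopology Int_absorb1)
  then have "almost_periodic X a x \<longleftrightarrow> (\<forall>y\<in>K. X closure_of orbit a y = K)"
    unfolding almost_periodic_def minimal_def K_def[symmetric] K(2) by simp
  also have "\<dots> \<longleftrightarrow> (\<forall>y\<in>K. x \<in> X closure_of orbit a y)"
  proof -
    have "K \<subseteq> X closure_of orbit a y" if "y \<in> K" "x \<in> X closure_of orbit a y" for y
      using orbit_closure_trans[OF f _ that(2)] that(1) K(1) by (auto simp: K_def)
    then show ?thesis
      using sub in_orbit_closure[OF f x] unfolding K_def[symmetric] by blast
  qed
  finally show ?thesis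
    unfolding K_def .
qed

lemma pointwise_almost_periodic_factor:
  assumes X: "flow X a" and Y: "flow Y b" and f: "extension X a Y b f"
    and pap: "pointwise_almost_periodic X a"
  shows "pointwise_almost_periodic Y b"
  unfolding pointwise_almost_periodic_def
proof
  fix y assume y: "y \<in> topspace Y"
  then obtain x where x: "x \<in> topspace X" "y = f x"
    using extension_surj[OF f] by blast
  show "almost_periodic Y b y"
    unfolding almost_periodic_iff[OF Y y]
  proof
    fix z assume "z \<in> Y closure_of orbit b y"
    then obtain w where w: "w \<in> X closure_of orbit a x" "z = f w"
      using extension_orbit_closure[OF X Y f x(1)] x(2) by blast
    then have wX: "w \<in> topspace X"
      by (simp add: in_closure_of)
    have "x \<in> X closure_of orbit a w"
      using pap x(1) w(1) almost_periodic_iff[OF X x(1)] by (auto simp: pointwise_almost_periodic_def)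
    then show "y \<in> Y closure_of orbit b z"
      using extension_orbit_closure[OF X Y f wX] x(2) w(2) by blast
  qed
qed

text \<open>
  A quasi-separable flow embeds equivariantly into a product of metrizable flows, so one coordinate
  separates two given distinct points. The image of that coordinate map is a subflow of a metrizable
  flow and has at least two points.
\<close>

lemma quasi_separable_metrizable_factor:
  fixes X :: "'a topology" and act :: "'s::topological_group_add \<Rightarrow> 'a \<Rightarrow> 'a"
  assumes X: "flow X act" and qs: "quasi_separable TYPE('i) TYPE('b) X act"
    and nontriv: "\<not> trivial_flow X"
  obtains Y :: "'b topology" and b :: "'s \<Rightarrow> 'b \<Rightarrow> 'b" and f
  where "flow Y b" "metrizable_space Y" "\<not> trivial_flow Y" "extension X act Y b f"
proof -
  obtain L :: "'i set" and r and Z :: "'i \<Rightarrow> 'b topology" and actZ p g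
    where sys: "inverse_system_of_flows L r Z actZ p" and met: "\<And>i. i \<in> L \<Longrightarrow> metrizable_space (Z i)"
    and iso: "flow_isomorphism X act (inverse_limit L r Z p) (inverse_limit_act L actZ) g"
    using qs unfolding quasi_separable_def by blast
  have hom: "homeomorphic_map X (inverse_limit L r Z p) g"
    and eqv: "\<And>t x. x \<in> topspace X \<Longrightarrow> g (act t x) = inverse_limit_act L actZ t (g x)"
    using iso by (auto simp: flow_isomorphism_def equivariant_def)
  have Z: "flow (Z i) (actZ i)" if "i \<in> L" for i
    using sys that by (auto simp: inverse_system_of_flows_def)
  have cg: "continuous_map X (product_topology Z L) g"
    using homeomorphic_imp_continuous_map[OF hom]
    by (simp add: inverse_limit_def continuous_map_in_subtopology)
  obtain x0 where x0: "x0 \<in> topspace X"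
    using flow_nonempty[OF X] by blast
  then obtain x1 where x1: "x1 \<in> topspace X" "x1 \<noteq> x0"
    using nontriv by (auto simp: trivial_flow_def)
  have gne: "g x0 \<noteq> g x1"
    using inj_onD[OF homeomorphic_imp_injective_map[OF hom] _ x0 x1(1)] x1(2) by blast
  have "g x0 \<in> topspace (product_topology Z L)" "g x1 \<in> topspace (product_topology Z L)"
    using x0 x1(1) continuous_map_image_subset_topspace[OF cg] by blast+
  then have "g x0 \<in> extensional L" "g x1 \<in> extensional L"
    by (auto simp: PiE_def)
  with gne obtain i where i: "i \<in> L" "g x0 i \<noteq> g x1 i"
    using extensionalityI by metis
  define f where "f = (\<lambda>x. g x i)"
  have cf: "continuous_map X (Z i) f"
    using continuous_map_compose[OF cg continuous_map_product_projection[OF i(1)]] by (simp add: f_def o_def)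
  have fact: "f (act t x) = actZ i t (f x)" if "x \<in> topspace X" for t x
    using eqv[OF that] i(1) by (simp add: f_def inverse_limit_act_def)
  define K where "K = f ` topspace X"
  have K: "closedin (Z i) K"
    unfolding K_def using continuous_imp_closed_map[OF cf flow_compact[OF X] flow_Hausdorff[OF Z[OF i(1)]]]
    by (simp add: closed_map_def)
  have inv: "actZ i t y \<in> K" if "y \<in> K" for t y
    using that flow_in_topspace[OF X] by (auto simp: K_def simp flip: fact)
  have top: "topspace (subtopology (Z i) K) = K"
    using closedin_subset[OF K] by (rule topspace_subtopology_subset)
  show ?thesis
  proof
    show "flow (subtopology (Z i) K) (actZ i)"
      using x0 inv by (intro flow_subflow[OF Z[OF i(1)] K]) (auto simp: K_def)
    show "metrizable_space (subtopology (Z i) K)"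
      using met[OF i(1)] by (rule metrizable_space_subtopology)
    show "\<not> trivial_flow (subtopology (Z i) K)"
    proof
      assume "trivial_flow (subtopology (Z i) K)"
      then obtain c where "K = {c}"
        unfolding trivial_flow_def top by blast
      moreover have "g x0 i \<in> K" "g x1 i \<in> K"
        using x0 x1(1) by (auto simp: K_def f_def)
      ultimately show False
        using i(2) by simp
    qed
    show "extension X act (subtopology (Z i) K) (actZ i) f"
      unfolding extension_def equivariant_def top
      using cf fact by (auto simp: continuous_map_in_subtopology K_def)
  qed
qed

section \<open>Metrizable flows and Baire category\<close>

text \<open>
  Total boundedness provides for each \<open>n\<close> finitely many balls of radius \<open>1/(n+1)\<close> that cover the
  space; these balls form the base.
\<close>

lemma compact_metrizable_countable_base:
  assumes "compact_space X" "metrizable_space X"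
  obtains \<B> where "countable \<B>" "\<And>B. B \<in> \<B> \<Longrightarrow> openin X B \<and> B \<noteq> {}"
    "\<And>U x. openin X U \<Longrightarrow> x \<in> U \<Longrightarrow> \<exists>B\<in>\<B>. x \<in> B \<and> B \<subseteq> U"
proof -
  obtain M d where M: "Metric_space M d" and X: "X = Metric_space.mtopology M d"
    using assms(2) by (auto simp: metrizable_space_def)
  interpret Metric_space M d by fact
  have "mtotally_bounded M"
    using assms(1) X by (simp add: compactin_imp_mtotally_bounded compact_space_def)
  then have "\<exists>K. finite K \<and> K \<subseteq> M \<and> M \<subseteq> (\<Union>x\<in>K. mball x (inverse (Suc n)))" for n
    by (simp add: mtotally_bounded_def)
  then obtain K where K: "\<And>n. finite (K n)" "\<And>n. K n \<subseteq> M"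
      "\<And>n. M \<subseteq> (\<Union>x\<in>K n. mball x (inverse (Suc n)))"
    by metis
  define \<B> where "\<B> = (\<Union>n. (\<lambda>x. mball x (inverse (Suc n))) ` K n)"
  show ?thesis
  proof
    show "countable \<B>"
      unfolding \<B>_def by (rule countable_UN[OF countableI_type]) (simp add: countable_finite K(1))
    show "openin X B \<and> B \<noteq> {}" if "B \<in> \<B>" for B
      using that K(2) by (fastforce simp: \<B>_def X)
    fix U x assume U: "openin X U" "x \<in> U"
    then have "U \<subseteq> M" and "\<exists>r>0. mball x r \<subseteq> U"
      by (simp_all add: X openin_mtopology)
    then obtain e where e: "e > 0" "mball x e \<subseteq> U" and x: "x \<in> M"
      using U(2) by blast
    obtain n where n: "inverse (Suc n) < e / 2"
      using reals_Archimedean[of "e / 2"] e(1) by auto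
    obtain c where c: "c \<in> K n" "x \<in> mball c (inverse (Suc n))"
      using K(3)[of n] x by blast
    have "mball c (inverse (Suc n)) \<subseteq> mball x e"
    proof
      fix y assume "y \<in> mball c (inverse (Suc n))"
      then show "y \<in> mball x e"
        using c(2) n triangle[of x c y] commute[of x c] by auto
    qed
    then show "\<exists>B\<in>\<B>. x \<in> B \<and> B \<subseteq> U"
      using c e(2) unfolding \<B>_def by blast
  qed
qed

lemma compact_Hausdorff_Baire:
  assumes "compact_space X" "Hausdorff_space X" "countable \<G>"
    and "\<And>T. T \<in> \<G> \<Longrightarrow> openin X T \<and> X closure_of T = topspace X"
  shows "X closure_of \<Inter>\<G> = topspace X"
  using assms
  by (intro Baire_category) (auto intro: compact_imp_locally_compact_space compact_Hausdorff_imp_regular_space)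

text \<open>
  The union of the translates of each basic open set is open and dense. Baire's theorem provides a
  point in all these unions, and the orbit of that point meets every basic open set. Countability comes
  from the base, since the group is arbitrary.
\<close>

lemma metrizable_transitive_point:
  assumes f: "flow X a" and m: "metrizable_space X" and tr: "topologically_transitive X a"
  obtains x where "x \<in> topspace X" "X closure_of orbit a x = topspace X"
proof -
  obtain \<B> where \<B>: "countable \<B>" "\<And>B. B \<in> \<B> \<Longrightarrow> openin X B \<and> B \<noteq> {}"
    and base: "\<And>U x. openin X U \<Longrightarrow> x \<in> U \<Longrightarrow> \<exists>B\<in>\<B>. x \<in> B \<and> B \<subseteq> U"
    using compact_metrizable_countable_base[OF flow_compact[OF f] m] by metis
  define D where "D B = (\<Union>t. a t ` B)" for B
  have open_image: "openin X (a t ` B)" if "openin X B" for t B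
  proof -
    have "a t ` B = {x \<in> topspace X. a (- t) x \<in> B}"
      using openin_subset[OF that] flow_inverse[OF f] flow_in_topspace[OF f]
      by (auto simp: image_iff subset_iff) (metis)
    then show ?thesis
      using openin_continuous_map_preimage[OF flow_continuous_act[OF f] that] by simp
  qed
  have "openin X T \<and> X closure_of T = topspace X" if "T \<in> D ` \<B>" for T
    using that \<B>(2) tr open_image by (auto simp: D_def topologically_transitive_def intro!: openin_Union)
  then have "X closure_of \<Inter>(D ` \<B>) = topspace X"
    using \<B>(1) by (intro compact_Hausdorff_Baire flow_compact[OF f] flow_Hausdorff[OF f]) auto
  then have "\<Inter>(D ` \<B>) \<inter> topspace X \<noteq> {}"
    using flow_nonempty[OF f] by (metis closure_of_empty closure_of_restrict inf_commute)
  then obtain x where x: "x \<in> topspace X" "\<And>B. B \<in> \<B> \<Longrightarrow> x \<in> D B"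
    by auto
  have "\<exists>y\<in>orbit a x. y \<in> U" if U: "openin X U" "z \<in> U" for U z
  proof -
    obtain B where B: "B \<in> \<B>" "B \<subseteq> U"
      using base[OF U] by blast
    then obtain t y where y: "y \<in> B" "x = a t y"
      using x(2)[OF B(1)] by (auto simp: D_def)
    then have "a (- t) x = y"
      using flow_inverse(1)[OF f] \<B>(2)[OF B(1)] openin_subset by blast
    then show ?thesis
      using y(1) B(2) unfolding orbit_def by (metis rangeI subsetD)
  qed
  then have "X closure_of orbit a x = topspace X"
    by (auto simp: closure_of_def)
  with x(1) show ?thesis
    by (rule that)
qed

lemma minimal_if_transitive_almost_periodic:
  assumes f: "flow X a" and "metrizable_space X" "topologically_transitive X a"
    and pap: "pointwise_almost_periodic X a"
  shows "minimal X a"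
proof -
  obtain x where x: "x \<in> topspace X" "X closure_of orbit a x = topspace X"
    using metrizable_transitive_point[OF assms(1-3)] .
  then have "almost_periodic X a x"
    using pap by (simp add: pointwise_almost_periodic_def)
  then show ?thesis
    by (simp add: almost_periodic_def x(2))
qed

text \<open>
  By compactness the sets \<open>{(x, y). d x y < 1/(n+1)}\<close> are cofinal among the neighbourhoods of the
  diagonal. So a proximal cell is a countable intersection of open sets, which makes it accessible to
  Baire's theorem.
\<close>

lemma metrizable_proximal_neighbourhoods:
  assumes f: "flow X a" and m: "metrizable_space X"
  obtains W :: "nat \<Rightarrow> ('a \<times> 'a) set"
  where "\<And>n. openin (prod_topology X X) (W n)" "\<And>n x. x \<in> topspace X \<Longrightarrow> (x, x) \<in> W n"
    "\<And>x y. x \<in> topspace X \<Longrightarrow> y \<in> topspace X \<Longrightarrow> (\<And>n. \<exists>t. (a t x, a t y) \<in> W n) \<Longrightarrow> (x, y) \<in> proximal_relation X a"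
proof -
  obtain M d where M: "Metric_space M d" and X: "X = Metric_space.mtopology M d"
    using m by (auto simp: metrizable_space_def)
  interpret Metric_space M d by fact
  have top: "topspace X = M"
    by (simp add: X)
  define W where "W n = {p \<in> topspace (prod_topology X X). d (fst p) (snd p) < inverse (Suc n)}" for n
  have cd: "continuous_map (prod_topology X X) euclideanreal (\<lambda>p. d (fst p) (snd p))"
    using continuous_map_mdist[of "prod_topology X X" Self fst snd]
    by (simp add: X mtopology_of_def continuous_map_fst continuous_map_snd)
  show ?thesis
  proof
    show "openin (prod_topology X X) (W n)" for n
      unfolding W_def using openin_continuous_map_preimage[OF cd, of "{..<inverse (Suc n)}"] by simp
    show "(x, x) \<in> W n" if "x \<in> topspace X" for n x
      using that by (simp add: W_def top)
    fix x y assume x: "x \<in> topspace X" and y: "y \<in> topspace X" and near: "\<And>n. \<exists>t. (a t x, a t y) \<in> W n"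
    show "(x, y) \<in> proximal_relation X a"
      unfolding proximal_iff_neighbourhoods[OF f x y]
    proof (intro allI impI, elim conjE)
      fix V assume V: "openin (prod_topology X X) V" "\<forall>z\<in>topspace X. (z, z) \<in> V"
      define D where "D = topspace (prod_topology X X) - V"
      have "closedin (prod_topology X X) D"
        unfolding D_def by (intro closedin_diff closedin_topspace V(1))
      then have "compactin (prod_topology X X) D"
        using flow_compact[OF flow_prod_act[OF f]] by (simp add: closedin_compact_space)
      then have "compact ((\<lambda>p. d (fst p) (snd p)) ` D)"
        using image_compactin[OF _ cd] by force
      moreover have "d (fst p) (snd p) > 0" if "p \<in> D" for p
        using that V(2) by (cases p) (auto simp: D_def top mdist_pos_eq)
      ultimately have "\<exists>e>0. \<forall>p\<in>D. e \<le> d (fst p) (snd p)"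
        using compact_attains_inf[of "(\<lambda>p. d (fst p) (snd p)) ` D"] by (cases "D = {}") (auto intro: zero_less_one)
      then obtain e where e: "e > 0" "\<And>p. p \<in> D \<Longrightarrow> e \<le> d (fst p) (snd p)"
        by blast
      obtain n where "inverse (Suc n) < e"
        using reals_Archimedean[OF e(1)] by auto
      moreover obtain t where "(a t x, a t y) \<in> W n"
        using near by blast
      ultimately have "(a t x, a t y) \<in> V"
        using e(2)[of "(a t x, a t y)"] by (force simp: W_def D_def)
      then show "\<exists>t. (a t x, a t y) \<in> V" ..
    qed
  qed
qed

section \<open>Lifting proximal pairs\<close>

text \<open>
  The points \<open>w\<close> with \<open>(w, w)\<close> in the given orbit closure form a closed invariant set; in a minimal flow
  it is everything as soon as it is nonempty.
\<close>

lemma proximal_minimal_diagonal: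
  assumes X: "flow X a" and min: "minimal X a" and p: "(x, y) \<in> proximal_relation X a" and w: "w \<in> topspace X"
  shows "(w, w) \<in> prod_topology X X closure_of orbit (prod_act a) (x, y)"
proof -
  define K where "K = prod_topology X X closure_of orbit (prod_act a) (x, y)"
  have xy: "(x, y) \<in> topspace (prod_topology X X)"
    using p by (auto simp: proximal_relation_def)
  define D where "D = {z \<in> topspace X. (z, z) \<in> K}"
  have "continuous_map X (prod_topology X X) (\<lambda>v. (v, v))"
    by (simp add: continuous_map_pairwise o_def)
  then have "closedin X D"
    unfolding D_def K_def by (rule closedin_continuous_map_preimage) simp
  moreover have "D \<noteq> {}"
    using p by (auto simp: proximal_relation_def D_def K_def Id_on_def)
  moreover have "a t z \<in> D" if "z \<in> D" for t z
    using that orbit_closure_invariant[OF flow_prod_act[OF X] xy, of "(z, z)" t] flow_in_topspace[OF X]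
    by (auto simp: D_def K_def prod_act_def)
  ultimately have "D = topspace X"
    using min unfolding minimal_iff_closed_invariant[OF X] by blast
  then show ?thesis
    using w by (auto simp: D_def K_def)
qed

lemma extension_proximal:
  assumes X: "flow X a" and Y: "flow Y b" and f: "extension X a Y b f" and p: "(x, y) \<in> proximal_relation X a"
  shows "(f x, f y) \<in> proximal_relation Y b"
proof -
  have xy: "(x, y) \<in> topspace (prod_topology X X)"
    using p by (auto simp: proximal_relation_def)
  obtain z where z: "z \<in> topspace X" "(z, z) \<in> prod_topology X X closure_of orbit (prod_act a) (x, y)"
    using p by (auto simp: proximal_relation_def Id_on_def)
  have "map_prod f f (z, z) \<in> map_prod f f ` (prod_topology X X closure_of orbit (prod_act a) (x, y))"
    using z(2) by (rule imageI)
  then have "(f z, f z) \<in> prod_topology Y Y closure_of orbit (prod_act b) (f x, f y)"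
    using extension_orbit_closure[OF flow_prod_act[OF X] flow_prod_act[OF Y] extension_prod_act[OF f] xy] by simp
  moreover have "f z \<in> topspace Y" "f x \<in> topspace Y" "f y \<in> topspace Y"
    using z(1) xy extension_surj[OF f] by auto
  ultimately show ?thesis
    by (auto simp: proximal_relation_def Id_on_def)
qed

abbreviation self_maps :: "'a topology \<Rightarrow> ('a \<Rightarrow> 'a) topology" where
  "self_maps X \<equiv> product_topology (\<lambda>x. X) (topspace X)"

lemma self_maps_in: "p \<in> topspace (self_maps X) \<Longrightarrow> x \<in> topspace X \<Longrightarrow> p x \<in> topspace X"
  by auto

lemma self_maps_flow:
  assumes "flow X a"
  shows "compact_space (self_maps X)" "Hausdorff_space (self_maps X)"
  using flow_compact[OF assms] flow_Hausdorff[OF assms]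
  by (auto simp: compact_space_product_topology Hausdorff_space_product_topology)

lemma continuous_eval: "x \<in> topspace X \<Longrightarrow> continuous_map (self_maps X) X (\<lambda>p. p x)"
  by (rule continuous_map_product_projection)

text \<open>
  Composition of arbitrary self-maps is continuous in the outer map. In the inner map it is continuous
  only if the outer map is, which is why the enveloping semigroup is handled one side at a time below.
\<close>

lemma continuous_compose_right:
  assumes q: "q \<in> topspace (self_maps X)"
  shows "continuous_map (self_maps X) (self_maps X) (\<lambda>p. compose (topspace X) p q)"
proof (rule continuous_map_coordinatewise_then_product)
  fix x assume x: "x \<in> topspace X"
  then show "continuous_map (self_maps X) X (\<lambda>p. compose (topspace X) p q x)"
    using continuous_eval[OF self_maps_in[OF q x]] by (simp add: compose_def)
qed (simp add: compose_def)

lemma continuous_compose_left: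
  assumes g: "continuous_map X X g"
  shows "continuous_map (self_maps X) (self_maps X) (compose (topspace X) g)"
proof (rule continuous_map_coordinatewise_then_product)
  fix x assume x: "x \<in> topspace X"
  then show "continuous_map (self_maps X) X (\<lambda>p. compose (topspace X) g p x)"
    using continuous_map_compose[OF continuous_eval[OF x] g] by (simp add: compose_def o_def)
qed (simp add: compose_def)

lemma self_maps_compose_assoc:
  assumes "r \<in> topspace (self_maps X)"
  shows "compose (topspace X) (compose (topspace X) p q) r = compose (topspace X) p (compose (topspace X) q r)"
  using self_maps_in[OF assms] by (auto simp: compose_def fun_eq_iff)

text \<open>
  The Ellis--Numakura lemma. In a minimal closed subsemigroup \<open>M\<close> with \<open>u \<in> M\<close>, the closed
  subsemigroup \<open>M u\<close> must be \<open>M\<close>, so some \<open>p\<close> satisfies \<open>p u = u\<close>; the set of all such \<open>p\<close> is again a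
  closed subsemigroup, hence \<open>M\<close>, and contains \<open>u\<close>.
\<close>

lemma compact_semigroup_idempotent:
  assumes c: "compact_space (self_maps X)" and h: "Hausdorff_space (self_maps X)"
    and T: "closedin (self_maps X) T" "T \<noteq> {}" "\<And>p q. p \<in> T \<Longrightarrow> q \<in> T \<Longrightarrow> compose (topspace X) p q \<in> T"
  obtains u where "u \<in> T" "compose (topspace X) u u = u"
proof -
  let ?c = "compose (topspace X)"
  define P where "P M \<longleftrightarrow> (\<forall>p\<in>M. \<forall>q\<in>M. ?c p q \<in> M)" for M
  obtain M where M: "closedin (self_maps X) M" "M \<noteq> {}" "P M" "M \<subseteq> T"
    and min: "\<And>B. closedin (self_maps X) B \<Longrightarrow> B \<noteq> {} \<Longrightarrow> P B \<Longrightarrow> B \<subseteq> M \<Longrightarrow> B = M"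
  proof (rule compact_minimal_closedin[OF c T(1,2)])
    show "P T"
      using T(3) by (simp add: P_def)
    show "P (\<Inter>\<B>)" if "\<And>B. B \<in> \<B> \<Longrightarrow> P B" for \<B>
      using that unfolding P_def by blast
  qed blast
  obtain u where u: "u \<in> M"
    using M(2) by blast
  have top: "p \<in> topspace (self_maps X)" if "p \<in> M" for p
    using closedin_subset[OF M(1)] that by blast
  have closed_c: "?c p q \<in> M" if "p \<in> M" "q \<in> M" for p q
    using M(3) that by (simp add: P_def)
  note cont = continuous_compose_right[OF top[OF u]]
  have "(\<lambda>p. ?c p u) ` M = M"
  proof (rule min)
    show "closedin (self_maps X) ((\<lambda>p. ?c p u) ` M)"
      using continuous_imp_closed_map[OF cont c h] M(1) by (simp add: closed_map_def)
    show "P ((\<lambda>p. ?c p u) ` M)"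
      unfolding P_def
    proof clarify
      fix p q assume pq: "p \<in> M" "q \<in> M"
      have "?c (?c p u) (?c q u) = ?c (?c (?c p u) q) u"
        by (rule self_maps_compose_assoc[OF top[OF u], symmetric])
      then show "?c (?c p u) (?c q u) \<in> (\<lambda>p. ?c p u) ` M"
        using closed_c pq u by auto
    qed
  qed (use u closed_c in auto)
  then obtain p where p: "p \<in> M" "?c p u = u"
    using u by (metis imageE)
  define B where "B = M \<inter> {p \<in> topspace (self_maps X). ?c p u \<in> {u}}"
  have "B = M"
  proof (rule min)
    show "closedin (self_maps X) B"
      unfolding B_def
      by (intro closedin_Int M(1) closedin_continuous_map_preimage[OF cont]
          closedin_Hausdorff_singleton[OF h top[OF u]])
    show "B \<noteq> {}"
      using p top[OF p(1)] by (auto simp: B_def)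
    show "P B"
      unfolding P_def
    proof (intro ballI)
      fix p q assume pq: "p \<in> B" "q \<in> B"
      then have "?c (?c p q) u = u"
        by (simp add: self_maps_compose_assoc[OF top[OF u]] B_def)
      moreover have "?c p q \<in> M"
        using pq by (intro closed_c) (auto simp: B_def)
      ultimately show "?c p q \<in> B"
        using top by (simp add: B_def)
    qed
  qed (auto simp: B_def)
  then have "?c u u = u"
    using u by (auto simp: B_def)
  moreover have "u \<in> T"
    using u M(4) by blast
  ultimately show ?thesis
    by (intro that)
qed

definition enveloping_semigroup :: "'a topology \<Rightarrow> ('s \<Rightarrow> 'a \<Rightarrow> 'a) \<Rightarrow> ('a \<Rightarrow> 'a) set" where
  "enveloping_semigroup X a = self_maps X closure_of (range (\<lambda>t. restrict (a t) (topspace X)))"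

lemma closedin_enveloping: "closedin (self_maps X) (enveloping_semigroup X a)"
  by (simp add: enveloping_semigroup_def)

lemma enveloping_self_map: "p \<in> enveloping_semigroup X a \<Longrightarrow> p \<in> topspace (self_maps X)"
  by (rule subsetD[OF closedin_subset[OF closedin_enveloping]])

lemma translation_in_enveloping:
  assumes "flow X a"
  shows "restrict (a t) (topspace X) \<in> enveloping_semigroup X a"
proof -
  have "range (\<lambda>t. restrict (a t) (topspace X)) \<subseteq> topspace (self_maps X)"
    using flow_in_topspace[OF assms] by auto
  from closure_of_subset[OF this] show ?thesis
    unfolding enveloping_semigroup_def by blast
qed

lemma enveloping_least:
  assumes "closedin (self_maps X) C" "\<And>t. restrict (a t) (topspace X) \<in> C"
  shows "enveloping_semigroup X a \<subseteq> C"
  unfolding enveloping_semigroup_def using assms by (intro closure_of_minimal) auto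

text \<open>
  First the outer factor is a translation, hence continuous, and the inner factor runs through the
  closure of the translations; then the outer factor runs through that closure.
\<close>

lemma enveloping_compose:
  assumes X: "flow X a" and p: "p \<in> enveloping_semigroup X a" and q: "q \<in> enveloping_semigroup X a"
  shows "compose (topspace X) p q \<in> enveloping_semigroup X a"
proof -
  let ?E = "enveloping_semigroup X a" and ?c = "compose (topspace X)"
  note top = enveloping_self_map[of _ X a]
  have left: "?c (a t) r \<in> ?E" if r: "r \<in> ?E" for t r
  proof -
    have "?E \<subseteq> {r \<in> topspace (self_maps X). ?c (a t) r \<in> ?E}"
    proof (rule enveloping_least)
      show "closedin (self_maps X) {r \<in> topspace (self_maps X). ?c (a t) r \<in> ?E}"
        by (rule closedin_continuous_map_preimage[OF continuous_compose_left[OF flow_continuous_act[OF X]] closedin_enveloping])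
      fix s
      have "?c (a t) (restrict (a s) (topspace X)) = restrict (a (t + s)) (topspace X)"
        by (auto simp: compose_def fun_eq_iff flow_add[OF X])
      then show "restrict (a s) (topspace X) \<in> {r \<in> topspace (self_maps X). ?c (a t) r \<in> ?E}"
        using translation_in_enveloping[OF X, of "t + s"] top[OF translation_in_enveloping[OF X, of s]] by simp
    qed
    then show ?thesis
      using r by blast
  qed
  have "?E \<subseteq> {r \<in> topspace (self_maps X). ?c r q \<in> ?E}"
  proof (rule enveloping_least)
    show "closedin (self_maps X) {r \<in> topspace (self_maps X). ?c r q \<in> ?E}"
      by (rule closedin_continuous_map_preimage[OF continuous_compose_right[OF top[OF q]] closedin_enveloping])
    fix t
    have "?c (restrict (a t) (topspace X)) q = ?c (a t) q"
      using self_maps_in[OF top[OF q]] by (auto simp: compose_def fun_eq_iff)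
    then show "restrict (a t) (topspace X) \<in> {r \<in> topspace (self_maps X). ?c r q \<in> ?E}"
      using left[OF q, of t] top[OF translation_in_enveloping[OF X]] by simp
  qed
  then show ?thesis
    using p by blast
qed

lemma enveloping_orbit_closure:
  assumes X: "flow X a" and xy: "x \<in> topspace X" "y \<in> topspace X"
  shows "(\<lambda>p. (p x, p y)) ` enveloping_semigroup X a = prod_topology X X closure_of orbit (prod_act a) (x, y)"
proof -
  let ?E = "enveloping_semigroup X a" and ?O = "orbit (prod_act a) (x, y)"
  have c: "continuous_map (self_maps X) (prod_topology X X) (\<lambda>p. (p x, p y))"
    using continuous_eval[OF xy(1)] continuous_eval[OF xy(2)] by (simp add: continuous_map_pairwise o_def)
  have O: "?O = (\<lambda>p. (p x, p y)) ` range (\<lambda>t. restrict (a t) (topspace X))"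
    using xy by (auto simp: orbit_def prod_act_def image_image)
  show ?thesis
  proof
    show "(\<lambda>p. (p x, p y)) ` ?E \<subseteq> prod_topology X X closure_of ?O"
      unfolding O enveloping_semigroup_def by (rule continuous_map_image_closure_subset[OF c])
    show "prod_topology X X closure_of ?O \<subseteq> (\<lambda>p. (p x, p y)) ` ?E"
    proof (rule closure_of_minimal)
      show "?O \<subseteq> (\<lambda>p. (p x, p y)) ` ?E"
        unfolding O using translation_in_enveloping[OF X] by (intro image_mono) auto
      show "closedin (prod_topology X X) ((\<lambda>p. (p x, p y)) ` ?E)"
        using continuous_imp_closed_map[OF c self_maps_flow(1)[OF X] flow_Hausdorff[OF flow_prod_act[OF X]]] closedin_enveloping
        by (auto simp: closed_map_def)
    qed
  qed
qed

lemma enveloping_respects_factor: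
  assumes X: "flow X a" and Y: "flow Y b" and f: "extension X a Y b f"
    and p: "p \<in> enveloping_semigroup X a" and z: "z \<in> topspace X" "z' \<in> topspace X" "f z = f z'"
  shows "f (p z) = f (p z')"
proof -
  have c: "continuous_map (self_maps X) Y (\<lambda>p. f (p x))" if "x \<in> topspace X" for x
    using continuous_map_compose[OF continuous_eval[OF that] extension_continuous[OF f]] by (simp add: o_def)
  have "enveloping_semigroup X a \<subseteq> {p \<in> topspace (self_maps X). f (p z) = f (p z')}"
  proof (rule enveloping_least)
    show "closedin (self_maps X) {p \<in> topspace (self_maps X). f (p z) = f (p z')}"
      using closedin_continuous_maps_eq[OF flow_Hausdorff[OF Y] c[OF z(1)] c[OF z(2)]] .
    show "restrict (a t) (topspace X) \<in> {p \<in> topspace (self_maps X). f (p z) = f (p z')}" for t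
      using z extension_act[OF f] flow_in_topspace[OF X] by auto
  qed
  then show ?thesis
    using p by blast
qed

text \<open>
  The Auslander--Ellis argument, relative to a factor. Since \<open>f x\<close> and \<open>y\<close> are proximal and \<open>Y\<close> is
  minimal, some element of the enveloping semigroup sends the fibres over both \<open>f x\<close> and \<open>y\<close> into
  the fibre over \<open>y\<close>. The elements with this property form a closed subsemigroup, which contains an
  idempotent \<open>u\<close>. As \<open>u\<close> takes the same value at \<open>x\<close> and at \<open>u x\<close>, these two points are proximal,
  and \<open>u x\<close> lies over \<open>y\<close>.
\<close>

proposition proximal_lift:
  assumes X: "flow X a" and Y: "flow Y b" and f: "extension X a Y b f" and min: "minimal Y b"
    and x: "x \<in> topspace X" and p: "(f x, y) \<in> proximal_relation Y b"
  obtains x' where "(x, x') \<in> proximal_relation X a" "f x' = y"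
proof -
  let ?E = "enveloping_semigroup X a"
  have y: "y \<in> topspace Y"
    using p by (auto simp: proximal_relation_def)
  then have "y \<in> f ` topspace X"
    by (simp add: extension_surj[OF f])
  then obtain v where v: "v \<in> topspace X" "f v = y"
    by auto
  note top = enveloping_self_map[of _ X a]
  have "(y, y) \<in> prod_topology Y Y closure_of orbit (prod_act b) (map_prod f f (x, v))"
    using proximal_minimal_diagonal[OF Y min p y] v(2) by simp
  also have "\<dots> = map_prod f f ` (prod_topology X X closure_of orbit (prod_act a) (x, v))"
    using x v(1) by (intro extension_orbit_closure[OF flow_prod_act[OF X] flow_prod_act[OF Y] extension_prod_act[OF f], symmetric]) auto
  also have "\<dots> = map_prod f f ` (\<lambda>p. (p x, p v)) ` ?E"
    by (simp add: enveloping_orbit_closure[OF X x v(1)])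
  finally obtain r where r: "r \<in> ?E" "f (r x) = y" "f (r v) = y"
    by auto
  define Z where "Z = {z \<in> topspace X. f z = f x \<or> f z = y}"
  define T where "T = ?E \<inter> (\<Inter>z\<in>Z. {p \<in> topspace (self_maps X). f (p z) \<in> {y}})"
  have "closedin (self_maps X) T"
    unfolding T_def
  proof (intro closedin_Int closedin_enveloping closedin_Inter)
    show "(\<lambda>z. {p \<in> topspace (self_maps X). f (p z) \<in> {y}}) ` Z \<noteq> {}"
      using x by (auto simp: Z_def)
    fix C assume "C \<in> (\<lambda>z. {p \<in> topspace (self_maps X). f (p z) \<in> {y}}) ` Z"
    then obtain z where z: "z \<in> topspace X" "C = {p \<in> topspace (self_maps X). f (p z) \<in> {y}}"
      by (auto simp: Z_def)
    have "continuous_map (self_maps X) Y (\<lambda>p. f (p z))"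
      using continuous_map_compose[OF continuous_eval[OF z(1)] extension_continuous[OF f]] by (simp add: o_def)
    then show "closedin (self_maps X) C"
      unfolding z(2) by (rule closedin_continuous_map_preimage) (rule closedin_Hausdorff_singleton[OF flow_Hausdorff[OF Y] y])
  qed
  moreover have "r \<in> T"
  proof -
    have "f (r z) = y" if z: "z \<in> Z" for z
      using z r enveloping_respects_factor[OF X Y f r(1), of z x] enveloping_respects_factor[OF X Y f r(1), of z v] x v
      by (auto simp: Z_def)
    then show ?thesis
      using r(1) top[OF r(1)] by (simp add: T_def)
  qed
  moreover have "compose (topspace X) p q \<in> T" if "p \<in> T" "q \<in> T" for p q
  proof -
    have pq: "p \<in> ?E" "q \<in> ?E" "\<And>z. z \<in> Z \<Longrightarrow> f (p z) = y" "\<And>z. z \<in> Z \<Longrightarrow> f (q z) = y"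
      using that by (auto simp: T_def)
    have "q z \<in> Z" if "z \<in> Z" for z
      using pq(4)[OF that] self_maps_in[OF top[OF pq(2)]] that by (auto simp: Z_def)
    then have "f (compose (topspace X) p q z) = y" if "z \<in> Z" for z
      using pq(3) that by (auto simp: compose_def Z_def)
    moreover have "compose (topspace X) p q \<in> ?E"
      by (rule enveloping_compose[OF X pq(1,2)])
    ultimately show ?thesis
      using top by (simp add: T_def)
  qed
  ultimately obtain u where u: "u \<in> T" "compose (topspace X) u u = u"
    using compact_semigroup_idempotent[OF self_maps_flow[OF X]] by (metis empty_iff)
  have uE: "u \<in> ?E"
    using u(1) by (simp add: T_def)
  have ux: "u x \<in> topspace X" "u (u x) = u x"
    using self_maps_in[OF top[OF uE] x] fun_cong[OF u(2), of x] x by (auto simp: compose_def)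
  have "(u x, u (u x)) \<in> prod_topology X X closure_of orbit (prod_act a) (x, u x)"
    unfolding enveloping_orbit_closure[OF X x ux(1), symmetric] using uE by blast
  then have "(x, u x) \<in> proximal_relation X a"
    using ux x by (auto simp: proximal_relation_def Id_on_def)
  moreover have "f (u x) = y"
    using u(1) x by (auto simp: T_def Z_def)
  ultimately show ?thesis
    by (rule that)
qed

lemma proximal_cell_factor:
  assumes X: "flow X a" and Y: "flow Y b" and f: "extension X a Y b f" and min: "minimal Y b"
    and x: "x \<in> topspace X"
  shows "f ` proximal_cell X a x = proximal_cell Y b (f x)"
proof
  show "f ` proximal_cell X a x \<subseteq> proximal_cell Y b (f x)"
    using extension_proximal[OF X Y f] extension_surj[OF f] by (auto simp: proximal_cell_def)
  show "proximal_cell Y b (f x) \<subseteq> f ` proximal_cell X a x"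
  proof
    fix y assume "y \<in> proximal_cell Y b (f x)"
    then obtain x' where "(x, x') \<in> proximal_relation X a" "f x' = y"
      using proximal_lift[OF X Y f min x] by (auto simp: proximal_cell_def)
    then show "y \<in> f ` proximal_cell X a x"
      by (auto simp: proximal_cell_def proximal_relation_def)
  qed
qed

text \<open>
  Let \<open>M\<close> be a minimal set in the orbit closure of \<open>(x, y, z)\<close>. It contains a point \<open>(x, v, w)\<close>. The
  pair \<open>(x, v)\<close> is proximal, so the orbit closure of \<open>(x, v, w)\<close>, which lies in \<open>M\<close>, meets the closed
  invariant set of triples with equal first two coordinates; by minimality \<open>M\<close> lies in that set. The
  same holds for the first and third coordinates, so \<open>(x, x, x)\<close> is in the orbit closure of
  \<open>(x, y, z)\<close>, and \<open>y\<close> and \<open>z\<close> are proximal.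
\<close>

lemma proximal_if_full_cell:
  assumes X: "flow X a" and min: "minimal X a" and x: "x \<in> topspace X" and cell: "proximal_cell X a x = topspace X"
  shows "proximal X a"
proof -
  let ?P = "prod_topology X X" and ?b = "prod_act a"
  let ?T = "prod_topology X ?P" and ?c = "\<lambda>t. map_prod (a t) (prod_act a t)"
  have fP: "flow ?P ?b"
    by (rule flow_prod_act[OF X])
  have fT: "flow ?T ?c"
    by (rule flow_prod[OF X fP])
  have c1: "continuous_map ?T X fst" and c2: "continuous_map ?T X (\<lambda>p. fst (snd p))" and c3: "continuous_map ?T X (\<lambda>p. snd (snd p))"
    using continuous_map_fst[of X ?P] continuous_map_compose[OF continuous_map_snd[of X ?P] continuous_map_fst[of X X]]
      continuous_map_compose[OF continuous_map_snd[of X ?P] continuous_map_snd[of X X]] by (simp_all add: o_def)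
  have e1: "extension ?T ?c X a fst"
    using c1 x by (auto simp: extension_def equivariant_def image_iff)
  have e12: "extension ?T ?c ?P ?b (\<lambda>p. (fst p, fst (snd p)))"
    using c1 c2 by (auto simp: extension_def equivariant_def prod_act_def continuous_map_pairwise o_def image_iff)
  have e13: "extension ?T ?c ?P ?b (\<lambda>p. (fst p, snd (snd p)))"
    using c1 c3 by (auto simp: extension_def equivariant_def prod_act_def continuous_map_pairwise o_def image_iff)
  have e23: "extension ?T ?c ?P ?b snd"
    using x by (auto simp: extension_def equivariant_def continuous_map_snd image_iff)
  have prox: "(x, y) \<in> proximal_relation X a" if "y \<in> topspace X" for y
    using that cell by (auto simp: proximal_cell_def)
  have "(y, z) \<in> proximal_relation X a" if yz: "y \<in> topspace X" "z \<in> topspace X" for y z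
  proof -
    have xyz: "(x, y, z) \<in> topspace ?T"
      using x yz by simp
    obtain M where M: "closedin ?T M" "M \<noteq> {}" "M \<subseteq> ?T closure_of orbit ?c (x, y, z)" "\<And>t p. p \<in> M \<Longrightarrow> ?c t p \<in> M"
      and fM: "flow (subtopology ?T M) ?c" and minM: "minimal (subtopology ?T M) ?c"
    proof (rule minimal_subflow_exists[OF fT closedin_closure_of])
      show "?T closure_of orbit ?c (x, y, z) \<noteq> {}"
        using in_orbit_closure[OF fT xyz] by blast
      show "?c t p \<in> ?T closure_of orbit ?c (x, y, z)" if "p \<in> ?T closure_of orbit ?c (x, y, z)" for t p
        using orbit_closure_invariant[OF fT xyz that] .
    qed blast
    have topM: "topspace (subtopology ?T M) = M"
      using closedin_subset[OF M(1)] by (rule topspace_subtopology_subset)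
    have "fst ` M = topspace X"
    proof -
      have "closedin X (fst ` M)"
        by (rule extension_closed_image[OF fT X e1 M(1)])
      moreover have "\<forall>t. \<forall>w\<in>fst ` M. a t w \<in> fst ` M"
        using M(4) by force
      ultimately show ?thesis
        using min M(2) unfolding minimal_iff_closed_invariant[OF X] by blast
    qed
    then obtain v w where vw: "(x, v, w) \<in> M"
      using x by force
    then have vwX: "(x, v, w) \<in> topspace ?T" "v \<in> topspace X" "w \<in> topspace X"
      using closedin_subset[OF M(1)] by auto
    have orb: "?T closure_of orbit ?c (x, v, w) \<subseteq> M"
      by (rule orbit_closure_least[OF fT M(1) vw M(4)])
    have collapse: "g p = fst p"
      if g: "extension ?T ?c ?P ?b (\<lambda>p. (fst p, g p))" "continuous_map ?T X g" and gv: "g (x, v, w) \<in> topspace X" and p: "p \<in> M" for g p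
    proof -
      have "(x, x) \<in> ?P closure_of orbit ?b (x, g (x, v, w))"
        by (rule proximal_minimal_diagonal[OF X min prox[OF gv] x])
      then have "(x, x) \<in> (\<lambda>p. (fst p, g p)) ` (?T closure_of orbit ?c (x, v, w))"
        unfolding extension_orbit_closure[OF fT fP g(1) vwX(1)] by simp
      then obtain q where q: "q \<in> M" "g q = fst q"
        using orb by auto
      define B where "B = M \<inter> {p \<in> topspace ?T. g p = fst p}"
      have "closedin ?T B"
        unfolding B_def by (intro closedin_Int M(1) closedin_continuous_maps_eq[OF flow_Hausdorff[OF X] g(2) c1])
      then have "closedin (subtopology ?T M) B"
        by (rule closedin_subset_topspace) (auto simp: B_def)
      moreover have "B \<noteq> {}"
        using q closedin_subset[OF M(1)] by (auto simp: B_def)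
      moreover have "\<forall>t. \<forall>p\<in>B. ?c t p \<in> B"
      proof (intro allI ballI)
        fix t p assume p: "p \<in> B"
        then have pT: "p \<in> topspace ?T"
          by (simp add: B_def)
        have "(fst (?c t p), g (?c t p)) = ?b t (fst p, g p)"
          using extension_act[OF g(1) pT] .
        then have "g (?c t p) = fst (?c t p)"
          using p by (simp add: B_def prod_act_def)
        then show "?c t p \<in> B"
          using p M(4) flow_in_topspace[OF fT pT] by (simp add: B_def)
      qed
      ultimately have "B = M"
        using minM unfolding minimal_iff_closed_invariant[OF fM] topM by blast
      then show ?thesis
        using p by (auto simp: B_def)
    qed
    have "v = x" "w = x"
      using collapse[OF e12 c2 _ vw] collapse[OF e13 c3 _ vw] vwX by auto
    then have "snd (x, x, x) \<in> snd ` (?T closure_of orbit ?c (x, y, z))"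
      using vw M(3) by (intro imageI) auto
    then have "(x, x) \<in> ?P closure_of orbit ?b (y, z)"
      unfolding extension_orbit_closure[OF fT fP e23 xyz] by simp
    then show ?thesis
      using x yz by (auto simp: proximal_relation_def Id_on_def)
  qed
  then show ?thesis
    unfolding proximal_def using proximal_relation_subset[of X a] by auto
qed

section \<open>Invariant means\<close>

abbreviation cfun :: "'a topology \<Rightarrow> ('a \<Rightarrow> real) \<Rightarrow> bool" where
  "cfun X \<equiv> continuous_map X euclideanreal"

text \<open>
  The means on the continuous real functions: the positive linear functionals with value 1 at the
  constant function 1. On a compact Hausdorff space they are, by Riesz, the regular Borel probability
  measures. The value 0 off the continuous functions makes a mean determined by its values at continuous
  functions, and the set of means compact for pointwise convergence at all functions.
\<close>

definition means :: "'a topology \<Rightarrow> (('a \<Rightarrow> real) \<Rightarrow> real) set" where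
  "means X = {m. (\<forall>f. \<not> cfun X f \<longrightarrow> m f = 0) \<and>
     (\<forall>f g. cfun X f \<and> cfun X g \<longrightarrow> m (\<lambda>x. f x + g x) = m f + m g) \<and>
     (\<forall>c f. cfun X f \<longrightarrow> m (\<lambda>x. c * f x) = c * m f) \<and>
     (\<forall>f. cfun X f \<and> (\<forall>x\<in>topspace X. 0 \<le> f x) \<longrightarrow> 0 \<le> m f) \<and>
     m (\<lambda>x. 1) = 1}"

definition mean_act :: "'a topology \<Rightarrow> ('s \<Rightarrow> 'a \<Rightarrow> 'a) \<Rightarrow> 's \<Rightarrow> (('a \<Rightarrow> real) \<Rightarrow> real) \<Rightarrow> ('a \<Rightarrow> real) \<Rightarrow> real" where
  "mean_act X a t m f = (if cfun X f then m (\<lambda>x. f (a t x)) else 0)"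

definition mean_mid :: "(('a \<Rightarrow> real) \<Rightarrow> real) \<Rightarrow> (('a \<Rightarrow> real) \<Rightarrow> real) \<Rightarrow> ('a \<Rightarrow> real) \<Rightarrow> real" where
  "mean_mid m n f = (m f + n f) / 2"

lemma meansD:
  assumes "m \<in> means X"
  shows mean_off: "\<not> cfun X f \<Longrightarrow> m f = 0"
    and mean_add: "cfun X f \<Longrightarrow> cfun X g \<Longrightarrow> m (\<lambda>x. f x + g x) = m f + m g"
    and mean_scale: "cfun X f \<Longrightarrow> m (\<lambda>x. c * f x) = c * m f"
    and mean_nonneg: "cfun X f \<Longrightarrow> (\<And>x. x \<in> topspace X \<Longrightarrow> 0 \<le> f x) \<Longrightarrow> 0 \<le> m f"
    and mean_one: "m (\<lambda>x. 1) = 1"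
  using assms by (auto simp: means_def)

lemma mean_const: "m \<in> means X \<Longrightarrow> m (\<lambda>x. c) = c"
  using mean_scale[of m X "\<lambda>x. 1" c] mean_one[of m X] by simp

lemma mean_diff:
  assumes "m \<in> means X" "cfun X f" "cfun X g"
  shows "m (\<lambda>x. f x - g x) = m f - m g"
proof -
  have "cfun X (\<lambda>x. f x - g x)"
    using assms by (intro continuous_intros)
  from mean_add[OF assms(1) this assms(3)] show ?thesis
    by simp
qed

lemma mean_mono:
  assumes "m \<in> means X" "cfun X f" "cfun X g" "\<And>x. x \<in> topspace X \<Longrightarrow> f x \<le> g x"
  shows "m f \<le> m g"
proof -
  have "0 \<le> m (\<lambda>x. g x - f x)"
    using assms by (intro mean_nonneg[OF assms(1)] continuous_intros) auto
  then show ?thesis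
    using mean_diff[OF assms(1,3,2)] by simp
qed

lemma mean_cong:
  assumes "m \<in> means X" "cfun X f" "\<And>x. x \<in> topspace X \<Longrightarrow> f x = g x"
  shows "m f = m g"
proof -
  have "cfun X g"
    using continuous_map_eq[OF assms(2,3)] .
  then show ?thesis
    using mean_mono[of m X f g] mean_mono[of m X g f] assms by force
qed

lemma mean_dist:
  assumes m: "m \<in> means X" and f: "cfun X f" and g: "cfun X g"
    and e: "\<And>x. x \<in> topspace X \<Longrightarrow> \<bar>f x - g x\<bar> \<le> e"
  shows "\<bar>m f - m g\<bar> \<le> e"
proof -
  have c: "cfun X (\<lambda>x. f x - g x)"
    using f g by (intro continuous_intros)
  have "m (\<lambda>x. f x - g x) \<le> e"
    using mean_mono[OF m c, of "\<lambda>x. e"] mean_const[OF m, of e] e by (force simp: abs_le_iff)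
  moreover have "- e \<le> m (\<lambda>x. f x - g x)"
    using mean_mono[OF m _ c, of "\<lambda>x. - e"] mean_const[OF m, of "- e"] e by (force simp: abs_le_iff)
  ultimately show ?thesis
    using mean_diff[OF m f g] by simp
qed

lemma dirac_mean:
  assumes "x \<in> topspace X"
  shows "(\<lambda>f. if cfun X f then f x else 0) \<in> means X"
proof -
  have "cfun X (\<lambda>x. f x + g x)" if "cfun X f" "cfun X g" for f g
    using that by (intro continuous_intros)
  moreover have "cfun X (\<lambda>x. c * f x)" if "cfun X f" for c f
    using that by (intro continuous_intros)
  ultimately show ?thesis
    using assms by (simp add: means_def)
qed

text \<open>
  Banach--Alaoglu for means: they form a closed subset of a product of compact intervals.
\<close>

lemma compact_means:
  assumes X: "compact_space X"
  shows "compact (means X)"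
proof -
  have "\<exists>b. \<forall>x\<in>topspace X. \<bar>f x\<bar> \<le> b" if "cfun X f" for f
  proof -
    have "compact (f ` topspace X)"
      using image_compactin[OF _ that] X by (simp add: compact_space_def)
    then show ?thesis
      using compact_imp_bounded bounded_iff by (metis (no_types, lifting) imageI real_norm_def)
  qed
  then obtain b where b: "\<And>f x. cfun X f \<Longrightarrow> x \<in> topspace X \<Longrightarrow> \<bar>f x\<bar> \<le> b f"
    by metis
  define B where "B f = (if cfun X f then {- b f..b f} else {0})" for f
  have sub: "means X \<subseteq> PiE UNIV B"
  proof
    fix m assume m: "m \<in> means X"
    have "m f \<in> B f" for f
    proof (cases "cfun X f")
      case True
      then have "\<bar>m f\<bar> \<le> b f"
        using mean_dist[OF m True, of "\<lambda>x. 0" "b f"] mean_const[OF m, of 0] b[OF True] by simp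
      with True show ?thesis
        by (auto simp: B_def)
    qed (use mean_off[OF m] in \<open>auto simp: B_def\<close>)
    then show "m \<in> PiE UNIV B"
      by auto
  qed
  have "compactin (product_topology (\<lambda>i. euclidean) UNIV) (PiE UNIV B)"
    unfolding compactin_PiE by (auto simp: B_def)
  then have cB: "compact (PiE UNIV B)"
    by (simp add: euclidean_product_topology)
  have imp: "closed {m :: ('a \<Rightarrow> real) \<Rightarrow> real. A \<longrightarrow> Q m}" if "closed {m. Q m}" for A Q
    using that by (cases A) auto
  have "closed (means X)"
    unfolding means_def
    by (intro closed_Collect_conj closed_Collect_all imp closed_Collect_eq closed_Collect_le
        continuous_on_add continuous_on_mult continuous_on_const continuous_on_product_coordinates)
  then show ?thesis
    using compact_Int_closed[OF cB, of "means X"] sub by (simp add: Int_absorb1)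
qed

lemma cfun_act:
  assumes "flow X a" "cfun X f"
  shows "cfun X (\<lambda>x. f (a t x))"
  using continuous_map_compose[OF flow_continuous_act[OF assms(1)] assms(2)] by (simp add: o_def)

lemma mean_act_in_means:
  assumes X: "flow X a" and m: "m \<in> means X"
  shows "mean_act X a t m \<in> means X"
proof -
  have "cfun X (\<lambda>x. f x + g x)" if "cfun X f" "cfun X g" for f g
    using that by (intro continuous_intros)
  moreover have "cfun X (\<lambda>x. c * f x)" if "cfun X f" for c f
    using that by (intro continuous_intros)
  moreover have "0 \<le> m (\<lambda>x. f (a t x))" if "cfun X f" "\<forall>x\<in>topspace X. 0 \<le> f x" for f
    using that flow_in_topspace[OF X] by (intro mean_nonneg[OF m] cfun_act[OF X]) auto
  ultimately show ?thesis
    unfolding means_def[of X]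
    by (simp add: mean_act_def cfun_act[OF X] mean_add[OF m] mean_scale[OF m] mean_one[OF m])
qed

text \<open>
  Joint continuity of the action and the tube lemma along the compact phase space. Through this lemma
  the topology of the group enters the continuity of the action on means.
\<close>

lemma action_uniformly_continuous:
  assumes X: "flow X a" and f: "cfun X f" and e: "e > 0"
  obtains N where "open N" "t0 \<in> N" "\<And>t x. t \<in> N \<Longrightarrow> x \<in> topspace X \<Longrightarrow> \<bar>f (a t x) - f (a t0 x)\<bar> < e"
proof -
  let ?T = "prod_topology euclidean X"
  define W where "W = {p \<in> topspace ?T. \<bar>f (a (fst p) (snd p)) - f (a t0 (snd p))\<bar> \<in> {..<e}}"
  have "continuous_map ?T euclideanreal (f \<circ> (\<lambda>(t, x). a t x))"
    by (rule continuous_map_compose[OF flow_continuous[OF X] f])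
  then have 1: "continuous_map ?T euclideanreal (\<lambda>p. f (a (fst p) (snd p)))"
    by (simp add: o_def case_prod_unfold)
  have 2: "continuous_map ?T euclideanreal (\<lambda>p. f (a t0 (snd p)))"
    using continuous_map_compose[OF continuous_map_snd cfun_act[OF X f, of t0], of euclidean] by (simp add: o_def)
  have "openin ?T W"
    unfolding W_def
  proof (rule openin_continuous_map_preimage)
    show "continuous_map ?T euclideanreal (\<lambda>p. \<bar>f (a (fst p) (snd p)) - f (a t0 (snd p))\<bar>)"
      using 1 2 by (intro continuous_intros)
  qed simp
  moreover have "{t0} \<times> topspace X \<subseteq> W"
    using e by (auto simp: W_def)
  ultimately obtain N V where "open N" "t0 \<in> N" "topspace X \<subseteq> V" "N \<times> V \<subseteq> W"
    using tube_lemma_right[of euclidean X W "topspace X" t0] flow_compact[OF X] by (auto simp: compact_space_def)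
  then have "(t, x) \<in> W" if "t \<in> N" "x \<in> topspace X" for t x
    using that by blast
  with \<open>open N\<close> \<open>t0 \<in> N\<close> show ?thesis
    by (intro that[of N]) (auto simp: W_def)
qed

lemma mean_act_continuous:
  assumes X: "flow X a"
  shows "continuous_on (UNIV \<times> means X) (\<lambda>(t, m). mean_act X a t m)"
proof (rule continuous_on_coordinatewise_then_product)
  fix f
  show "continuous_on (UNIV \<times> means X) (\<lambda>p. (case p of (t, m) \<Rightarrow> mean_act X a t m) f)"
  proof (cases "cfun X f")
    case False
    then show ?thesis
      by (simp add: mean_act_def case_prod_unfold)
  next
    case f: True
    let ?S = "UNIV \<times> means X"
    have "((\<lambda>p. snd p (\<lambda>x. f (a (fst p) x))) \<longlongrightarrow> snd p0 (\<lambda>x. f (a (fst p0) x))) (at p0 within ?S)" for p0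
    proof (rule tendstoI)
      fix e :: real assume e: "e > 0"
      define g where "g = (\<lambda>x. f (a (fst p0) x))"
      obtain N where N: "open N" "fst p0 \<in> N"
        "\<And>t x. t \<in> N \<Longrightarrow> x \<in> topspace X \<Longrightarrow> \<bar>f (a t x) - f (a (fst p0) x)\<bar> < e / 2"
        using action_uniformly_continuous[OF X f, of "e / 2"] e by auto
      have "\<forall>\<^sub>F p in at p0 within ?S. fst p \<in> N"
        using topological_tendstoD[OF tendsto_fst[OF tendsto_ident_at] N(1,2)] .
      moreover have "continuous_on UNIV (\<lambda>p :: 'b \<times> (('a \<Rightarrow> real) \<Rightarrow> real). snd p g)"
        by (rule continuous_on_compose2[OF continuous_on_product_coordinates continuous_on_snd[OF continuous_on_id]]) auto
      then have "((\<lambda>p. snd p g) \<longlongrightarrow> snd p0 g) (at p0)"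
        unfolding continuous_on_def by blast
      then have "((\<lambda>p. snd p g) \<longlongrightarrow> snd p0 g) (at p0 within ?S)"
        by (rule tendsto_within_subset) simp
      then have "\<forall>\<^sub>F p in at p0 within ?S. dist (snd p g) (snd p0 g) < e / 2"
        using e by (intro tendstoD) auto
      moreover have "\<forall>\<^sub>F p in at p0 within ?S. p \<in> ?S"
        by (simp add: eventually_at_filter)
      ultimately show "\<forall>\<^sub>F p in at p0 within ?S. dist (snd p (\<lambda>x. f (a (fst p) x))) (snd p0 (\<lambda>x. f (a (fst p0) x))) < e"
      proof eventually_elim
        case (elim p)
        have p: "snd p \<in> means X"
          using elim(3) by auto
        have "\<bar>snd p (\<lambda>x. f (a (fst p) x)) - snd p (\<lambda>x. f (a (fst p0) x))\<bar> \<le> e / 2"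
          by (rule mean_dist[OF p cfun_act[OF X f] cfun_act[OF X f]]) (use N(3)[OF elim(1)] less_imp_le in blast)
        with elim(2) show ?case
          unfolding g_def dist_real_def by linarith
      qed
    qed
    with f show ?thesis
      by (simp add: continuous_on_def mean_act_def case_prod_unfold)
  qed
qed

text \<open>
  The action on means is jointly continuous for the given group topology; this matters because strong
  amenability speaks only of such flows.
\<close>

lemma flow_means:
  assumes X: "flow X a"
  shows "flow (top_of_set (means X)) (mean_act X a)"
proof -
  let ?M = "means X"
  obtain x where x: "x \<in> topspace X"
    using flow_nonempty[OF X] by blast
  have "?M \<noteq> {}"
    using dirac_mean[OF x] by blast
  moreover have "compact_space (top_of_set ?M)"
    using compact_means[OF flow_compact[OF X]] by (simp add: compact_space_subtopology)
  moreover have "Hausdorff_space (top_of_set ?M)"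
    by (simp add: Hausdorff_space_subtopology Hausdorff_space_product_topology flip: euclidean_product_topology)
  moreover have "continuous_map (prod_topology (top_of_set UNIV) (top_of_set ?M)) (top_of_set ?M) (\<lambda>(t, m). mean_act X a t m)"
    using mean_act_continuous[OF X] mean_act_in_means[OF X]
    by (auto simp del: subtopology_UNIV simp: continuous_map_in_subtopology)
  moreover have "mean_act X a 0 m = m" if m: "m \<in> ?M" for m
  proof
    fix f
    show "mean_act X a 0 m f = m f"
    proof (cases "cfun X f")
      case True
      then show ?thesis
        using mean_cong[OF m True, of "\<lambda>x. f (a 0 x)"] flow_zero[OF X] by (simp add: mean_act_def)
    qed (simp add: mean_act_def mean_off[OF m])
  qed
  moreover have "mean_act X a (s + t) m = mean_act X a s (mean_act X a t m)" if m: "m \<in> ?M" for s t m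
  proof
    fix f
    show "mean_act X a (s + t) m f = mean_act X a s (mean_act X a t m) f"
    proof (cases "cfun X f")
      case True
      have "m (\<lambda>x. f (a (s + t) x)) = m (\<lambda>x. f (a s (a t x)))"
        using True by (intro mean_cong[OF m] cfun_act[OF X]) (simp_all add: flow_add[OF X])
      with True show ?thesis
        by (simp add: mean_act_def cfun_act[OF X])
    qed (simp add: mean_act_def)
  qed
  ultimately show ?thesis
    by (simp add: flow_def)
qed

text \<open>
  Squared Euclidean norm of the vector of values at finitely many functions, as a convex function of
  the mean. That such norms come close to their maximum along orbits takes the place of extreme points
  in the argument below.
\<close>

definition sqnorm :: "('a \<Rightarrow> real) set \<Rightarrow> (('a \<Rightarrow> real) \<Rightarrow> real) \<Rightarrow> real" where
  "sqnorm F m = (\<Sum>f\<in>F. (m f)\<^sup>2)"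

lemma sqnorm_parallelogram:
  "sqnorm F (mean_mid m n) + sqnorm F (\<lambda>f. (m f - n f) / 2) = (sqnorm F m + sqnorm F n) / 2"
  unfolding sqnorm_def mean_mid_def sum.distrib[symmetric] sum_divide_distrib
  by (intro sum.cong refl) (simp add: power2_eq_square field_simps)

lemma sqnorm_nonneg: "0 \<le> sqnorm F m"
  by (simp add: sqnorm_def sum_nonneg)

lemma continuous_on_sqnorm: "continuous_on UNIV (sqnorm F)"
  unfolding sqnorm_def by (intro continuous_on_sum continuous_on_power continuous_on_product_coordinates)

lemma mean_mid_in_means:
  assumes m: "m \<in> means X" and n: "n \<in> means X"
  shows "mean_mid m n \<in> means X"
proof -
  have "cfun X (\<lambda>x. f x + g x)" if "cfun X f" "cfun X g" for f g
    using that by (intro continuous_intros)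
  moreover have "cfun X (\<lambda>x. c * f x)" if "cfun X f" for c f
    using that by (intro continuous_intros)
  ultimately show ?thesis
    unfolding means_def[of X]
    using mean_nonneg[OF m] mean_nonneg[OF n]
    by (simp add: mean_mid_def mean_off[OF m] mean_add[OF m] mean_scale[OF m] mean_one[OF m]
        mean_off[OF n] mean_add[OF n] mean_scale[OF n] mean_one[OF n] field_simps)
qed

lemma mean_act_mid: "mean_act X a t (mean_mid m n) = mean_mid (mean_act X a t m) (mean_act X a t n)"
  by (auto simp: mean_act_def mean_mid_def)

text \<open>
  \<open>Q\<close> is a minimal closed convex invariant set of means. The means in \<open>Q\<close> with \<open>sqnorm F \<le> c\<close> along the
  whole orbit form a closed invariant set that is convex because \<open>sqnorm F\<close> is. If it contains a point
  it is \<open>Q\<close>. Consequently every orbit in \<open>Q\<close> comes arbitrarily close to the supremum of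
  \<open>sqnorm F\<close> over \<open>Q\<close>. Convexity is used in the form of closure under midpoints.
\<close>

lemma irreducible_orbit_norm:
  assumes X: "flow X a" and Q: "closedin (top_of_set (means X)) Q"
    and inv: "\<And>t m. m \<in> Q \<Longrightarrow> mean_act X a t m \<in> Q"
    and mid: "\<And>m n. m \<in> Q \<Longrightarrow> n \<in> Q \<Longrightarrow> mean_mid m n \<in> Q"
    and min: "\<And>B. closedin (top_of_set (means X)) B \<Longrightarrow> B \<noteq> {} \<Longrightarrow> B \<subseteq> Q \<Longrightarrow>
      (\<And>t m. m \<in> B \<Longrightarrow> mean_act X a t m \<in> B) \<Longrightarrow> (\<And>m n. m \<in> B \<Longrightarrow> n \<in> B \<Longrightarrow> mean_mid m n \<in> B) \<Longrightarrow> B = Q"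
    and q: "q \<in> Q" "\<And>t. sqnorm F (mean_act X a t q) \<le> c" and m: "m \<in> Q"
  shows "sqnorm F m \<le> c"
proof -
  have QM: "Q \<subseteq> means X"
    using closedin_subset[OF Q] by simp
  define B where "B = Q \<inter> {m. \<forall>t. sqnorm F (mean_act X a t m) \<le> c}"
  have "continuous_on UNIV (mean_act X a t)" for t
  proof (rule continuous_on_coordinatewise_then_product)
    show "continuous_on UNIV (\<lambda>m. mean_act X a t m f)" for f
      by (cases "cfun X f") (simp_all add: mean_act_def)
  qed
  then have "continuous_on UNIV (\<lambda>m. sqnorm F (mean_act X a t m))" for t
    using continuous_on_compose2[OF continuous_on_sqnorm] by blast
  then have "closed {m. \<forall>t. sqnorm F (mean_act X a t m) \<le> c}"
    by (intro closed_Collect_all closed_Collect_le continuous_on_const)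
  moreover obtain T where "closed T" "Q = means X \<inter> T"
    using Q unfolding closedin_closed by blast
  ultimately have "closedin (top_of_set (means X)) B"
    unfolding B_def closedin_closed
    by (intro exI[of _ "T \<inter> {m. \<forall>t. sqnorm F (mean_act X a t m) \<le> c}"]) (auto intro: closed_Int)
  moreover have "q \<in> B"
    using q by (simp add: B_def)
  moreover have "mean_act X a t m \<in> B" if "m \<in> B" for t m
  proof -
    have "m \<in> topspace (top_of_set (means X))"
      using that QM by (auto simp: B_def)
    from flow_add[OF flow_means[OF X] this]
    have "mean_act X a s (mean_act X a t m) = mean_act X a (s + t) m" for s
      by simp
    then show ?thesis
      using that inv by (simp add: B_def)
  qed
  moreover have "mean_mid m n \<in> B" if "m \<in> B" "n \<in> B" for m n
  proof -
    have "sqnorm F (mean_act X a t (mean_mid m n)) \<le> c" for t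
    proof -
      have "sqnorm F (mean_act X a t m) \<le> c" "sqnorm F (mean_act X a t n) \<le> c"
        using that by (auto simp: B_def)
      then show ?thesis
        using sqnorm_parallelogram[of F "mean_act X a t m" "mean_act X a t n"]
          sqnorm_nonneg[of F "\<lambda>f. (mean_act X a t m f - mean_act X a t n f) / 2"]
        by (simp add: mean_act_mid)
    qed
    then show ?thesis
      using that mid by (simp add: B_def)
  qed
  moreover have "B \<subseteq> Q"
    by (auto simp: B_def)
  ultimately have "B = Q"
    by (intro min[of B]) auto
  then have "sqnorm F (mean_act X a 0 m) \<le> c"
    using m unfolding B_def by blast
  moreover have "mean_act X a 0 m = m"
    using m QM by (intro flow_zero[OF flow_means[OF X]]) auto
  ultimately show ?thesis
    by simp
qed

text \<open>
  On a minimal closed convex invariant set \<open>Q\<close> of means all pairs are proximal: the orbit of the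
  midpoint of \<open>m\<close> and \<open>n\<close> comes close to the supremum of \<open>sqnorm F\<close>, and by the parallelogram law the
  translates of \<open>m\<close> and \<open>n\<close> are then close to each other. A minimal flow inside \<open>Q\<close> is thus a minimal
  proximal flow, hence a single point, which is an invariant mean.
\<close>

lemma strongly_amenable_imp_invariant_mean:
  fixes a :: "'s::topological_group_add \<Rightarrow> 'a \<Rightarrow> 'a"
  assumes sa: "strongly_amenable TYPE('s)" and X: "flow X a"
  obtains m where "m \<in> means X" "\<And>t f. cfun X f \<Longrightarrow> m (\<lambda>x. f (a t x)) = m f"
proof -
  let ?M = "top_of_set (means X)"
  let ?b = "mean_act X a"
  have fM: "flow ?M ?b"
    by (rule flow_means[OF X])
  define P where "P Q \<longleftrightarrow> (\<forall>t. \<forall>m\<in>Q. ?b t m \<in> Q) \<and> (\<forall>m\<in>Q. \<forall>n\<in>Q. mean_mid m n \<in> Q)" for Q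
  obtain Q where Q: "closedin ?M Q" "Q \<noteq> {}" "P Q"
    and min: "\<And>B. closedin ?M B \<Longrightarrow> B \<noteq> {} \<Longrightarrow> P B \<Longrightarrow> B \<subseteq> Q \<Longrightarrow> B = Q"
  proof (rule compact_minimal_closedin[OF flow_compact[OF fM] closedin_topspace flow_nonempty[OF fM]])
    show "P (topspace ?M)"
      using mean_act_in_means[OF X] mean_mid_in_means by (auto simp: P_def)
    show "P (\<Inter>\<B>)" if "\<And>B. B \<in> \<B> \<Longrightarrow> P B" for \<B>
      using that unfolding P_def by blast
  qed blast
  have inv: "?b t m \<in> Q" if "m \<in> Q" for t m
    using Q(3) that by (simp add: P_def)
  have mid: "mean_mid m n \<in> Q" if "m \<in> Q" "n \<in> Q" for m n
    using Q(3) that by (simp add: P_def)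
  have QM: "Q \<subseteq> means X"
    using closedin_subset[OF Q(1)] by simp
  have norm_le: "sqnorm F m \<le> c" if "q \<in> Q" "\<And>t. sqnorm F (?b t q) \<le> c" "m \<in> Q" for F m q c
  proof (rule irreducible_orbit_norm[OF X Q(1) inv mid _ that])
    show "B = Q" if "closedin ?M B" "B \<noteq> {}" "B \<subseteq> Q" "\<And>t m. m \<in> B \<Longrightarrow> ?b t m \<in> B"
      "\<And>m n. m \<in> B \<Longrightarrow> n \<in> B \<Longrightarrow> mean_mid m n \<in> B" for B
      using that by (intro min) (auto simp: P_def)
  qed
  have close: "\<exists>t. sqnorm F (\<lambda>f. (?b t m f - ?b t n f) / 2) < e" if mn: "m \<in> Q" "n \<in> Q" and e: "e > 0" for F m n e
  proof -
    \<comment> \<open>the orbit of the midpoint almost attains the supremum of the norm over \<open>Q\<close>\<close>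
    define s where "s = (SUP k\<in>Q. sqnorm F k)"
    have "compact Q"
      using Q(1) compact_means[OF flow_compact[OF X]] closedin_compact by blast
    then have "compact (sqnorm F ` Q)"
      using continuous_on_sqnorm continuous_on_subset by (intro compact_continuous_image) blast+
    then have "bdd_above (sqnorm F ` Q)"
      by (intro bounded_imp_bdd_above compact_imp_bounded)
    then have le: "sqnorm F k \<le> s" if "k \<in> Q" for k
      unfolding s_def using that by (intro cSUP_upper)
    have "\<exists>t. s - e < sqnorm F (?b t (mean_mid m n))"
    proof (rule ccontr)
      assume "\<nexists>t. s - e < sqnorm F (?b t (mean_mid m n))"
      then have "sqnorm F k \<le> s - e" if "k \<in> Q" for k
        using norm_le[OF mid[OF mn] _ that] by (simp add: not_less)
      then have "s \<le> s - e"
        unfolding s_def using Q(2) by (intro cSUP_least) (auto simp: s_def)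
      then show False
        using e by simp
    qed
    then obtain t where "s - e < sqnorm F (?b t (mean_mid m n))" ..
    then have "sqnorm F (\<lambda>f. (?b t m f - ?b t n f) / 2) < e"
      using sqnorm_parallelogram[of F "?b t m" "?b t n"] le[OF inv[OF mn(1), of t]] le[OF inv[OF mn(2), of t]]
      by (simp add: mean_act_mid)
    then show ?thesis ..
  qed
  have proxQ: "(m, n) \<in> proximal_relation ?M ?b" if mn: "m \<in> Q" "n \<in> Q" for m n
  proof -
    define K where "K = prod_topology ?M ?M closure_of orbit (prod_act ?b) (m, n)"
    have fP: "flow (prod_topology ?M ?M) (prod_act ?b)"
      by (rule flow_prod_act[OF fM])
    have mnM: "(m, n) \<in> topspace (prod_topology ?M ?M)"
      using mn QM by auto
    have "compactin (prod_topology ?M ?M) K"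
      unfolding K_def by (intro closedin_compact_space flow_compact[OF fP] closedin_closure_of)
    then have K: "compact K" "K \<subseteq> means X \<times> means X"
      using compactin_subset_topspace by (force simp: compactin_subtopology)+
    have orbK: "(?b t m, ?b t n) \<in> K" for t
    proof -
      have "(?b t m, ?b t n) \<in> orbit (prod_act ?b) (m, n)"
        by (auto simp: orbit_def prod_act_def)
      then show ?thesis
        using closure_of_subset[OF orbit_subset[OF fP mnM]] unfolding K_def by blast
    qed
    have "\<exists>k. (k, k) \<in> K"
    proof (rule ccontr)
      assume none: "\<nexists>k. (k, k) \<in> K"
      have cont: "continuous_on UNIV (\<lambda>p :: (('a \<Rightarrow> real) \<Rightarrow> real) \<times> (('a \<Rightarrow> real) \<Rightarrow> real). fst p f - snd p f)" for f
        by (intro continuous_on_diff continuous_on_compose2[OF continuous_on_product_coordinates continuous_on_fst[OF continuous_on_id]]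
            continuous_on_compose2[OF continuous_on_product_coordinates continuous_on_snd[OF continuous_on_id]]) auto
      define U where "U f = {p :: (('a \<Rightarrow> real) \<Rightarrow> real) \<times> (('a \<Rightarrow> real) \<Rightarrow> real). fst p f - snd p f \<noteq> 0}" for f
      have opU: "open (U f)" for f
        unfolding U_def by (intro open_Collect_neq cont continuous_on_const)
      have cover: "K \<subseteq> (\<Union>f\<in>UNIV. U f)"
      proof
        fix p assume "p \<in> K"
        then have "fst p \<noteq> snd p"
          using none by (cases p) auto
        then show "p \<in> (\<Union>f\<in>UNIV. U f)"
          by (auto simp: U_def fun_eq_iff)
      qed
      obtain F where F: "finite F" "K \<subseteq> (\<Union>f\<in>F. U f)"
        by (rule compactE_image[OF K(1) opU cover])
      \<comment> \<open>a positive lower bound for the distance of \<open>K\<close> from the diagonal, against \<open>close\<close>\<close>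
      define h where "h p = sqnorm F (\<lambda>f. (fst p f - snd p f) / 2)" for p :: "(('a \<Rightarrow> real) \<Rightarrow> real) \<times> (('a \<Rightarrow> real) \<Rightarrow> real)"
      have "continuous_on K h"
        unfolding h_def sqnorm_def
        by (intro continuous_on_sum continuous_on_power continuous_on_divide continuous_on_subset[OF cont] continuous_on_const) auto
      then obtain p where p: "p \<in> K" "\<And>q. q \<in> K \<Longrightarrow> h p \<le> h q"
        using continuous_attains_inf[OF K(1), of h] orbK by (metis empty_iff)
      obtain f where "f \<in> F" "fst p f - snd p f \<noteq> 0"
        using F(2) p(1) by (auto simp: U_def)
      then have "0 < h p"
        unfolding h_def sqnorm_def using F(1) by (intro sum_pos2[of F f]) auto
      from close[OF mn this, of F] obtain t where "sqnorm F (\<lambda>f. (?b t m f - ?b t n f) / 2) < h p" ..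
      then show False
        using p(2)[OF orbK[of t]] by (simp add: h_def)
    qed
    then obtain k where k: "(k, k) \<in> K" ..
    then have "(k, k) \<in> Id_on (topspace ?M)"
      using K(2) by auto
    with k have "K \<inter> Id_on (topspace ?M) \<noteq> {}"
      by blast
    with mnM show ?thesis
      unfolding proximal_relation_def K_def by simp
  qed
  obtain N where N: "closedin ?M N" "N \<noteq> {}" "N \<subseteq> Q" and fN: "flow (subtopology ?M N) ?b" "minimal (subtopology ?M N) ?b"
    using minimal_subflow_exists[OF fM Q(1,2) inv] by metis
  have top: "topspace (subtopology ?M N) = N"
    using closedin_subset[OF N(1)] by (rule topspace_subtopology_subset)
  have "proximal (subtopology ?M N) ?b"
    using proximal_subflow[OF fM fN(1) N(1)] proxQ N(3) unfolding proximal_def top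
    by (auto simp: subset_iff)
  then have "trivial_flow (subtopology ?M N)"
    by (rule strongly_amenable_imp_trivial_flow[OF sa fN])
  then obtain m where "N = {m}"
    unfolding trivial_flow_def top by blast
  moreover have "?b t m \<in> N" for t
    using flow_in_topspace[OF fN(1), of m t] \<open>N = {m}\<close> unfolding top by simp
  ultimately have fix_m: "?b t m = m" for t
    by auto
  show ?thesis
  proof
    show "m \<in> means X"
      using \<open>N = {m}\<close> N(3) QM by blast
    show "m (\<lambda>x. f (a t x)) = m f" if "cfun X f" for t f
      using fun_cong[OF fix_m, of t f] that by (simp add: mean_act_def)
  qed
qed

section \<open>Sections of closed invariant sets\<close>

lemma closure_of_meets_open:
  assumes "y \<in> X closure_of S" "openin X U" "y \<in> U"
  obtains z where "z \<in> S" "z \<in> U"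
  using assms by (auto simp: in_closure_of)

text \<open>
  For closed \<open>F\<close> in a compact Hausdorff space this is the measure of \<open>F\<close> under the regular measure that represents \<open>m\<close>.
\<close>

definition mean_content :: "'a topology \<Rightarrow> (('a \<Rightarrow> real) \<Rightarrow> real) \<Rightarrow> 'a set \<Rightarrow> real" where
  "mean_content X m F = (INF f \<in> {f. cfun X f \<and> (\<forall>x\<in>topspace X. 0 \<le> f x) \<and> (\<forall>x\<in>F. 1 \<le> f x)}. m f)"

lemma content_le:
  assumes m: "m \<in> means X" and f: "cfun X f" "\<And>x. x \<in> topspace X \<Longrightarrow> 0 \<le> f x" "\<And>x. x \<in> F \<Longrightarrow> 1 \<le> f x"
  shows "mean_content X m F \<le> m f"
  unfolding mean_content_def
proof (rule cINF_lower)
  show "bdd_below (m ` {f. cfun X f \<and> (\<forall>x\<in>topspace X. 0 \<le> f x) \<and> (\<forall>x\<in>F. 1 \<le> f x)})"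
    by (rule bdd_belowI[of _ 0]) (auto intro: mean_nonneg[OF m])
qed (use f in auto)

lemma content_less_iff:
  assumes m: "m \<in> means X"
  shows "mean_content X m F < r \<longleftrightarrow>
    (\<exists>f. cfun X f \<and> (\<forall>x\<in>topspace X. 0 \<le> f x) \<and> (\<forall>x\<in>F. 1 \<le> f x) \<and> m f < r)"
proof -
  let ?S = "{f. cfun X f \<and> (\<forall>x\<in>topspace X. 0 \<le> f x) \<and> (\<forall>x\<in>F. 1 \<le> f x)}"
  have "(\<lambda>x. 1) \<in> ?S"
    by simp
  then have "?S \<noteq> {}"
    by blast
  moreover have "bdd_below (m ` ?S)"
    by (rule bdd_belowI[of _ 0]) (auto intro: mean_nonneg[OF m])
  ultimately show ?thesis
    unfolding mean_content_def by (subst cINF_less_iff) auto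
qed

lemma content_mono:
  assumes "m \<in> means X" "F \<subseteq> G"
  shows "mean_content X m F \<le> mean_content X m G"
proof (rule ccontr)
  assume "\<not> mean_content X m F \<le> mean_content X m G"
  then obtain f where "cfun X f" "\<forall>x\<in>topspace X. 0 \<le> f x" "\<forall>x\<in>G. 1 \<le> f x" "m f < mean_content X m F"
    using content_less_iff[OF assms(1), of G] by (auto simp: not_le)
  then show False
    using content_le[OF assms(1), of f F] assms(2) by force
qed

text \<open>
  Pass to the maximum and the minimum of two test functions, whose sum is the sum of the functions.
  This inequality yields the triangle inequality for the pseudometric on sections below.
\<close>

lemma content_strongly_subadditive:
  assumes m: "m \<in> means X" and B: "B \<subseteq> F \<inter> G"
  shows "mean_content X m (F \<union> G) + mean_content X m B \<le> mean_content X m F + mean_content X m G"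
proof (rule field_le_epsilon)
  fix e :: real assume e: "e > 0"
  obtain f where f: "cfun X f" "\<forall>x\<in>topspace X. 0 \<le> f x" "\<forall>x\<in>F. 1 \<le> f x" "m f < mean_content X m F + e / 2"
    using content_less_iff[OF m, of F "mean_content X m F + e / 2"] e by auto
  obtain g where g: "cfun X g" "\<forall>x\<in>topspace X. 0 \<le> g x" "\<forall>x\<in>G. 1 \<le> g x" "m g < mean_content X m G + e / 2"
    using content_less_iff[OF m, of G "mean_content X m G + e / 2"] e by auto
  have c: "cfun X (\<lambda>x. max (f x) (g x))" "cfun X (\<lambda>x. min (f x) (g x))"
    using f(1) g(1) by (auto intro: continuous_map_real_max continuous_map_real_min)
  have "mean_content X m (F \<union> G) \<le> m (\<lambda>x. max (f x) (g x))"
    using f g by (intro content_le[OF m c(1)]) (auto simp: le_max_iff_disj)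
  moreover have "mean_content X m B \<le> m (\<lambda>x. min (f x) (g x))"
    using f g B by (intro content_le[OF m c(2)]) auto
  moreover have "m (\<lambda>x. max (f x) (g x)) + m (\<lambda>x. min (f x) (g x)) = m f + m g"
    unfolding mean_add[OF m c, symmetric] mean_add[OF m f(1) g(1), symmetric]
    by (rule arg_cong[where f = m]) (auto simp: max_def min_def)
  ultimately show "mean_content X m (F \<union> G) + mean_content X m B \<le> mean_content X m F + mean_content X m G + e"
    using f(4) g(4) by linarith
qed

text \<open>
  A test function \<open>f\<close> for \<open>F\<close> is at least \<open>d\<close> on the open set \<open>U = {f > d}\<close>, so \<open>f / d\<close> is a test
  function for \<open>U\<close>; with \<open>d < 1\<close> close to 1 its mean is still below \<open>r\<close>.
\<close>

lemma content_upper_semicontinuous: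
  assumes m: "m \<in> means X" and F: "F \<subseteq> topspace X" "mean_content X m F < r"
  obtains U where "openin X U" "F \<subseteq> U" "mean_content X m U < r"
proof -
  obtain f where f: "cfun X f" "\<forall>x\<in>topspace X. 0 \<le> f x" "\<forall>x\<in>F. 1 \<le> f x" "m f < r"
    using content_less_iff[OF m] F(2) by auto
  have r: "0 \<le> m f" "0 < r"
    using mean_nonneg[OF m f(1)] f(2,4) by auto
  \<comment> \<open>any number strictly between \<open>m f / r\<close> and 1\<close>
  define d where "d = (1 + m f / r) / 2"
  have d: "0 < d" "d < 1" "m f < d * r"
    using r f(4) by (auto simp: d_def field_simps)
  define U where "U = {x \<in> topspace X. f x \<in> {d<..}}"
  have "mean_content X m U \<le> m (\<lambda>x. inverse d * f x)"
    using d f by (intro content_le[OF m] continuous_map_real_mult_left) (auto simp: U_def field_simps)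
  also have "\<dots> < r"
    unfolding mean_scale[OF m f(1)] using d by (simp add: field_simps)
  finally have "mean_content X m U < r" .
  moreover have "openin X U"
    unfolding U_def by (rule openin_continuous_map_preimage[OF f(1)]) simp
  moreover have "F \<subseteq> U"
    using F(1) f(3) d(2) by (force simp: U_def)
  ultimately show ?thesis
    by (intro that)
qed

definition invariant_mean :: "'a topology \<Rightarrow> ('s \<Rightarrow> 'a \<Rightarrow> 'a) \<Rightarrow> (('a \<Rightarrow> real) \<Rightarrow> real) \<Rightarrow> bool" where
  "invariant_mean X a m \<longleftrightarrow> m \<in> means X \<and> (\<forall>t f. cfun X f \<longrightarrow> m (\<lambda>x. f (a t x)) = m f)"

lemma content_invariant_le:
  assumes X: "flow X a" and m: "invariant_mean X a m" and G: "\<And>x. x \<in> G \<Longrightarrow> a t x \<in> F"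
  shows "mean_content X m G \<le> mean_content X m F"
proof (rule ccontr)
  assume "\<not> mean_content X m G \<le> mean_content X m F"
  then obtain f where f: "cfun X f" "\<forall>x\<in>topspace X. 0 \<le> f x" "\<forall>x\<in>F. 1 \<le> f x" "m f < mean_content X m G"
    using content_less_iff[of m X F] m by (auto simp: not_le invariant_mean_def)
  have "mean_content X m G \<le> m (\<lambda>x. f (a t x))"
    using f m G flow_in_topspace[OF X] by (intro content_le cfun_act[OF X]) (auto simp: invariant_mean_def)
  then show False
    using f m by (auto simp: invariant_mean_def)
qed

text \<open>
  An invariant mean on a minimal flow has full support: finitely many translates of the open set where
  \<open>h\<close> exceeds \<open>h y / 2\<close> cover the phase space, so the sum of the corresponding translates of \<open>h\<close> is
  bounded below by a positive constant.
\<close>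

lemma invariant_mean_pos:
  assumes X: "flow X a" and min: "minimal X a" and m: "invariant_mean X a m"
    and h: "cfun X h" "\<And>x. x \<in> topspace X \<Longrightarrow> 0 \<le> h x" and y: "y \<in> topspace X" "0 < h y"
  shows "0 < m h"
proof -
  have mm: "m \<in> means X"
    using m by (simp add: invariant_mean_def)
  define V where "V t = {x \<in> topspace X. h (a t x) \<in> {h y / 2<..}}" for t
  have opV: "openin X (V t)" for t
    unfolding V_def by (rule openin_continuous_map_preimage[OF cfun_act[OF X h(1)]]) simp
  have cover: "topspace X \<subseteq> (\<Union>t. V t)"
  proof
    fix x assume x: "x \<in> topspace X"
    have "y \<in> X closure_of orbit a x"
      using min x y(1) by (simp add: minimal_def)
    moreover have "openin X {z \<in> topspace X. h z \<in> {h y / 2<..}}"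
      by (rule openin_continuous_map_preimage[OF h(1)]) simp
    moreover have "y \<in> {z \<in> topspace X. h z \<in> {h y / 2<..}}"
      using y by simp
    ultimately obtain z where "z \<in> orbit a x" "z \<in> {z \<in> topspace X. h z \<in> {h y / 2<..}}"
      by (rule closure_of_meets_open)
    then show "x \<in> (\<Union>t. V t)"
      using x by (auto simp: orbit_def V_def)
  qed
  moreover have "compactin X (topspace X)"
    using flow_compact[OF X] by (simp add: compact_space_def)
  ultimately have "\<exists>\<F>. finite \<F> \<and> \<F> \<subseteq> range V \<and> topspace X \<subseteq> \<Union>\<F>"
    by (intro compactinD) (auto simp: opV)
  then obtain \<F> where \<F>: "finite \<F>" "\<F> \<subseteq> V ` UNIV" "topspace X \<subseteq> \<Union>\<F>"
    by blast
  obtain T where "finite T" "\<F> = V ` T"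
    using finite_subset_image[OF \<F>(1,2)] by blast
  with \<F>(3) have T: "finite T" "topspace X \<subseteq> (\<Union>t\<in>T. V t)"
    by auto
  have c: "cfun X (\<lambda>x. h (a t x))" for t
    by (rule cfun_act[OF X h(1)])
  have sum: "cfun X (\<lambda>x. \<Sum>t\<in>S. h (a t x)) \<and> m (\<lambda>x. \<Sum>t\<in>S. h (a t x)) = card S * m h" if "finite S" for S
    using that
  proof induction
    case empty
    then show ?case
      using mean_const[OF mm, of 0] by simp
  next
    case (insert t S)
    then have "cfun X (\<lambda>x. h (a t x) + (\<Sum>t\<in>S. h (a t x)))"
      using c by (intro continuous_map_add) auto
    moreover have "m (\<lambda>x. h (a t x) + (\<Sum>t\<in>S. h (a t x))) = m h + card S * m h"
      using insert m mean_add[OF mm c] h(1) by (simp add: invariant_mean_def)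
    ultimately show ?case
      using insert by (simp add: algebra_simps)
  qed
  have "h y / 2 \<le> (\<Sum>t\<in>T. h (a t x))" if x: "x \<in> topspace X" for x
  proof -
    obtain t where "t \<in> T" "x \<in> V t"
      using T(2) x by blast
    then have "h y / 2 \<le> h (a t x)"
      by (simp add: V_def)
    also have "\<dots> \<le> (\<Sum>t\<in>T. h (a t x))"
      using \<open>t \<in> T\<close> T(1) h(2) flow_in_topspace[OF X x] by (intro member_le_sum) auto
    finally show ?thesis .
  qed
  then have "h y / 2 \<le> card T * m h"
    using mean_mono[OF mm _ conjunct1[OF sum[OF T(1)]], of "\<lambda>x. h y / 2"] mean_const[OF mm, of "h y / 2"] sum[OF T(1)]
    by simp
  then have "0 < card T * m h"
    using y(2) by linarith
  then show ?thesis
    by (simp add: zero_less_mult_iff)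
qed

text \<open>
  Upper semicontinuity of the sections of a closed set: projection along a compact factor is closed.
\<close>

lemma open_sections:
  assumes "compact_space Y" "closedin (prod_topology X Y) W" "openin Y U"
  shows "openin X {x \<in> topspace X. \<forall>y. (x, y) \<in> W \<longrightarrow> y \<in> U}"
proof -
  have "closedin (prod_topology X Y) (W \<inter> topspace X \<times> (topspace Y - U))"
    using assms by (intro closedin_Int) (auto simp: closedin_prod_Times_iff)
  then have "closedin X (fst ` (W \<inter> topspace X \<times> (topspace Y - U)))"
    using closed_map_fst[OF assms(1)] unfolding closed_map_def by blast
  then have "openin X (topspace X - fst ` (W \<inter> topspace X \<times> (topspace Y - U)))"
    by blast
  moreover have "topspace X - fst ` (W \<inter> topspace X \<times> (topspace Y - U)) = {x \<in> topspace X. \<forall>y. (x, y) \<in> W \<longrightarrow> y \<in> U}"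
    using closedin_subset[OF assms(2)] by (force simp: image_iff)
  ultimately show ?thesis
    by simp
qed

text \<open>
  McMahon's argument. Write \<open>S u\<close> for the section of \<open>W\<close> at \<open>u\<close> and let \<open>h u v\<close> be the content of
  \<open>S u \<union> S v\<close>. The function \<open>h\<close> is invariant and upper semicontinuous, so by minimality it is a constant
  \<open>k\<close> on the diagonal: all sections have content \<open>k\<close>. Strong subadditivity makes \<open>h u v - k\<close> (half the
  measure of the symmetric difference of the sections) a pseudometric. The set where it is small is open,
  invariant and contains the diagonal, hence dense by weak mixing, and with the triangle inequality the
  pseudometric vanishes. So any two sections agree up to content 0, and by full support an open set
  contained in one section is contained in every other.
\<close>

proposition open_in_one_section_imp_all:
  assumes X: "flow X a" and min: "minimal X a" and wm: "weakly_mixing X a"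
    and m: "invariant_mean X a m"
    and W: "closedin (prod_topology X X) W" "\<And>t x y. (x, y) \<in> W \<Longrightarrow> (a t x, a t y) \<in> W"
    and V: "openin X V" and x: "x \<in> topspace X" "{x} \<times> V \<subseteq> W"
  shows "topspace X \<times> V \<subseteq> W"
proof -
  have mm: "m \<in> means X"
    using m by (simp add: invariant_mean_def)
  have WX: "W \<subseteq> topspace X \<times> topspace X"
    using closedin_subset[OF W(1)] by simp
  define S where "S u = {y. (u, y) \<in> W}" for u
  have SX: "S u \<subseteq> topspace X" for u
    using WX by (auto simp: S_def)
  have S_act: "y \<in> S (a t u) \<Longrightarrow> a (- t) y \<in> S u" if "u \<in> topspace X" for y t u
    using W(2)[of "a t u" y "- t"] flow_inverse[OF X that] by (simp add: S_def)
  define h where "h u v = mean_content X m (S u \<union> S v)" for u v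
  have h_sym: "h u v = h v u" for u v
    by (simp add: h_def Un_commute)
  have h_act: "h (a t u) (a t v) \<le> h u v" if "u \<in> topspace X" "v \<in> topspace X" for t u v
    unfolding h_def using S_act that by (intro content_invariant_le[OF X m, of _ "- t"]) auto
  have h_usc: "openin (prod_topology X X) {p \<in> topspace (prod_topology X X). h (fst p) (snd p) < r}" for r
  proof (subst openin_subopen, intro ballI)
    fix p assume "p \<in> {p \<in> topspace (prod_topology X X). h (fst p) (snd p) < r}"
    then obtain u v where p: "p = (u, v)" "u \<in> topspace X" "v \<in> topspace X" "mean_content X m (S u \<union> S v) < r"
      by (auto simp: h_def)
    then obtain U where U: "openin X U" "S u \<union> S v \<subseteq> U" "mean_content X m U < r"
      using content_upper_semicontinuous[OF mm, of "S u \<union> S v"] SX by (metis Un_least)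
    define N where "N = {z \<in> topspace X. \<forall>y. (z, y) \<in> W \<longrightarrow> y \<in> U}"
    have "openin X N"
      unfolding N_def by (rule open_sections[OF flow_compact[OF X] W(1) U(1)])
    moreover have "(u, v) \<in> N \<times> N"
      using p U(2) by (auto simp: N_def S_def)
    moreover have "h u' v' < r" if "u' \<in> N" "v' \<in> N" for u' v'
    proof -
      have "h u' v' \<le> mean_content X m U"
        unfolding h_def using that by (intro content_mono[OF mm]) (auto simp: N_def S_def)
      then show ?thesis
        using U(3) by linarith
    qed
    ultimately show "\<exists>T. openin (prod_topology X X) T \<and> p \<in> T \<and> T \<subseteq> {p \<in> topspace (prod_topology X X). h (fst p) (snd p) < r}"
      unfolding p(1) by (intro exI[of _ "N \<times> N"]) (auto simp: openin_prod_Times_iff N_def)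
  qed
  have slice: "openin X {v \<in> topspace X. h u v < r}" if "u \<in> topspace X" for u r
  proof -
    have "continuous_map X (prod_topology X X) (\<lambda>v. (u, v))"
      using that by (simp add: continuous_map_pairwise o_def)
    from openin_continuous_map_preimage[OF this h_usc[of r]] show ?thesis
      using that by simp
  qed
  have diag: "continuous_map X (prod_topology X X) (\<lambda>v. (v, v))"
    by (simp add: continuous_map_pairwise o_def)
  have const: "h u u = h x x" if u: "u \<in> topspace X" for u
  proof -
    have "h v v \<le> h w w" if vw: "v \<in> topspace X" "w \<in> topspace X" for v w
    proof (rule dense_ge)
      fix r assume r: "h w w < r"
      have "{v \<in> topspace X. h v v < r} = topspace X"
      proof (rule minimal_open_invariant[OF X min])
        show "openin X {v \<in> topspace X. h v v < r}"
          using openin_continuous_map_preimage[OF diag h_usc[of r]] by simp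
        show "{v \<in> topspace X. h v v < r} \<noteq> {}"
          using vw r by auto
        show "a t z \<in> {v \<in> topspace X. h v v < r}" if "z \<in> {v \<in> topspace X. h v v < r}" for t z
          using that h_act[of z z t] flow_in_topspace[OF X, of z t] by simp
      qed
      then show "h v v \<le> r"
        using vw by force
    qed
    then show ?thesis
      using u x(1) by (simp add: order_antisym)
  qed
  define k where "k = h x x"
  have tri: "h u w + k \<le> h u v + h v w" if "v \<in> topspace X" for u v w
  proof -
    have "mean_content X m ((S u \<union> S v) \<union> (S v \<union> S w)) + mean_content X m (S v) \<le> h u v + h v w"
      unfolding h_def by (rule content_strongly_subadditive[OF mm]) auto
    moreover have "h u w \<le> mean_content X m ((S u \<union> S v) \<union> (S v \<union> S w))"
      unfolding h_def by (rule content_mono[OF mm]) auto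
    moreover have "mean_content X m (S v) = k"
      using const[OF that] by (simp add: h_def k_def)
    ultimately show ?thesis
      by linarith
  qed
  have small: "h u v \<le> k" if uv: "u \<in> topspace X" "v \<in> topspace X" for u v
  proof (rule field_le_epsilon)
    fix e :: real assume e: "e > 0"
    define r where "r = k + e / 3"
    define N where "N = {p \<in> topspace (prod_topology X X). h (fst p) (snd p) < r}"
    have "(x, x) \<in> N"
      using x(1) e by (simp add: N_def r_def k_def)
    then have "N \<noteq> {}"
      by blast
    then have "prod_topology X X closure_of (\<Union>t. prod_act a t ` N) = topspace (prod_topology X X)"
      using wm h_usc[of r] unfolding weakly_mixing_def topologically_transitive_def N_def by blast
    moreover have "(\<Union>t. prod_act a t ` N) \<subseteq> N"
    proof
      fix w assume "w \<in> (\<Union>t. prod_act a t ` N)"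
      then obtain t p q where "w = (a t p, a t q)" "(p, q) \<in> N"
        by (auto simp: prod_act_def)
      then show "w \<in> N"
        using h_act[of p q t] flow_in_topspace[OF X] by (simp add: N_def)
    qed
    ultimately have dense: "topspace (prod_topology X X) \<subseteq> prod_topology X X closure_of N"
      using closure_of_mono[of "\<Union>t. prod_act a t ` N" N "prod_topology X X"] by simp
    define A where "A w = {z \<in> topspace X. h w z < r}" for w
    have self: "w \<in> A w" if "w \<in> topspace X" for w
      using that const[OF that] e by (simp add: A_def r_def k_def)
    have "(u, v) \<in> prod_topology X X closure_of N"
      using dense uv by auto
    moreover have "openin (prod_topology X X) (A u \<times> A v)"
      using slice uv by (simp add: openin_prod_Times_iff A_def)
    moreover have "(u, v) \<in> A u \<times> A v"
      using self uv by blast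
    ultimately obtain p where "p \<in> N" "p \<in> A u \<times> A v"
      by (rule closure_of_meets_open)
    then obtain u' v' where *: "u' \<in> topspace X" "v' \<in> topspace X" "h u' v' < r" "h u u' < r" "h v v' < r"
      by (auto simp: N_def A_def)
    then show "h u v \<le> k + e"
      using tri[OF *(1), of u v] tri[OF *(2), of u' v] h_sym[of v v'] by (simp add: r_def)
  qed
  show ?thesis
  proof clarify
    fix u y assume u: "u \<in> topspace X" and y: "y \<in> V"
    show "(u, y) \<in> W"
    proof (rule ccontr)
      assume "(u, y) \<notin> W"
      then have ySu: "y \<notin> S u"
        by (simp add: S_def)
      have yX: "y \<in> topspace X"
        using openin_subset[OF V] y by blast
      have "closedin X (S u)"
      proof -
        have "continuous_map X (prod_topology X X) (\<lambda>v. (u, v))"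
          using u by (simp add: continuous_map_pairwise o_def)
        from closedin_continuous_map_preimage[OF this W(1)]
        have "closedin X {v \<in> topspace X. (u, v) \<in> W}" .
        moreover have "{v \<in> topspace X. (u, v) \<in> W} = S u"
          using SX[of u] by (auto simp: S_def)
        ultimately show ?thesis
          by simp
      qed
      then have "openin X (V - S u)"
        using V by (rule openin_diff[rotated])
      moreover have "completely_regular_space X"
        using flow_compact[OF X] flow_Hausdorff[OF X]
        by (simp add: compact_Hausdorff_or_regular_imp_normal_space normal_imp_completely_regular_space)
      ultimately obtain g where g: "cfun X g" "g y = 0" "g ` (topspace X - (V - S u)) \<subseteq> {1}"
        using y ySu unfolding completely_regular_space_alt' by blast
      \<comment> \<open>a bump at \<open>y\<close> inside \<open>V - S u\<close>; subtracting it from a test function for \<open>S x \<union> S u\<close> leaves one for \<open>S u\<close>\<close>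
      define q where "q = (\<lambda>x. max 0 (1 - \<bar>g x\<bar>))"
      have q: "cfun X q"
        unfolding q_def using g(1) by (intro continuous_map_real_max continuous_intros) auto
      have q01: "0 \<le> q z" "q z \<le> 1" for z
        by (auto simp: q_def)
      have q0: "q z = 0" if "z \<in> topspace X" "z \<notin> V - S u" for z
        using g(3) that by (force simp: q_def)
      have pos: "0 < m q"
        using q q01 yX g(2) by (intro invariant_mean_pos[OF X min m, of q y]) (auto simp: q_def)
      have "h x u < k + m q"
        using small[OF x(1) u] pos by linarith
      then obtain f where f: "cfun X f" "\<forall>z\<in>topspace X. 0 \<le> f z" "\<forall>z\<in>S x \<union> S u. 1 \<le> f z" "m f < k + m q"
        unfolding h_def content_less_iff[OF mm] by blast
      have c: "cfun X (\<lambda>z. f z - q z)"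
        using f(1) q by (intro continuous_intros)
      have "0 \<le> f z - q z" if z: "z \<in> topspace X" for z
      proof (cases "z \<in> V")
        case True
        then have "1 \<le> f z"
          using x(2) f(3) by (auto simp: S_def)
        then show ?thesis
          using q01[of z] by simp
      qed (use q0[OF z] f(2) z in auto)
      moreover have "1 \<le> f z - q z" if "z \<in> S u" for z
        using q0[of z] f(3) that SX[of u] by auto
      ultimately have "mean_content X m (S u) \<le> m f - m q"
        using content_le[OF mm c, of "S u"] mean_diff[OF mm f(1) q] by simp
      moreover have "mean_content X m (S u) = k"
        using const[OF u] by (simp add: h_def k_def)
      ultimately show False
        using f(4) by simp
    qed
  qed
qed

text \<open>
  The pairs that never enter \<open>D\<close> form a closed invariant set. If the points never brought close to \<open>x\<close>
  had interior \<open>V\<close>, the preceding proposition would put all of \<open>X \<times> V\<close>, and so a diagonal point, into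
  that set.
\<close>

lemma near_cell_dense:
  assumes X: "flow X a" and min: "minimal X a" and wm: "weakly_mixing X a" and m: "invariant_mean X a m"
    and D: "openin (prod_topology X X) D" "\<And>z. z \<in> topspace X \<Longrightarrow> (z, z) \<in> D" and x: "x \<in> topspace X"
  shows "openin X {y \<in> topspace X. \<exists>t. (a t x, a t y) \<in> D}"
    and "X closure_of {y \<in> topspace X. \<exists>t. (a t x, a t y) \<in> D} = topspace X"
proof -
  let ?P = "prod_topology X X"
  define E where "E = (\<Union>t. {p \<in> topspace ?P. prod_act a t p \<in> D})"
  have opE: "openin ?P E"
    unfolding E_def
    using openin_continuous_map_preimage[OF flow_continuous_act[OF flow_prod_act[OF X]] D(1)]
    by (intro openin_Union) auto
  have cx: "continuous_map X ?P (\<lambda>y. (x, y))"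
    using x by (simp add: continuous_map_pairwise o_def)
  have eq: "{y \<in> topspace X. \<exists>t. (a t x, a t y) \<in> D} = {y \<in> topspace X. (x, y) \<in> E}"
    using x by (auto simp: E_def prod_act_def)
  show "openin X {y \<in> topspace X. \<exists>t. (a t x, a t y) \<in> D}"
    unfolding eq using openin_continuous_map_preimage[OF cx opE] .
  define W where "W = topspace ?P - E"
  have W: "closedin ?P W"
    unfolding W_def by (intro closedin_diff closedin_topspace opE)
  have inv: "(a t u, a t v) \<in> W" if "(u, v) \<in> W" for t u v
  proof -
    have uv: "u \<in> topspace X" "v \<in> topspace X" "(u, v) \<notin> E"
      using that by (auto simp: W_def)
    then have "(a s (a t u), a s (a t v)) \<notin> D" for s
      using uv by (auto simp: E_def prod_act_def simp flip: flow_add[OF X])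
    then show ?thesis
      using uv flow_in_topspace[OF X] by (auto simp: W_def E_def prod_act_def)
  qed
  show "X closure_of {y \<in> topspace X. \<exists>t. (a t x, a t y) \<in> D} = topspace X"
  proof (rule ccontr)
    let ?C = "X closure_of {y \<in> topspace X. \<exists>t. (a t x, a t y) \<in> D}"
    assume "?C \<noteq> topspace X"
    then obtain y where y: "y \<in> topspace X - ?C"
      using closure_of_subset_topspace[of X] by blast
    have "openin X (topspace X - ?C)"
      by (intro openin_diff openin_topspace closedin_closure_of)
    moreover have "{x} \<times> (topspace X - ?C) \<subseteq> W"
    proof clarify
      fix v assume v: "v \<in> topspace X" "v \<notin> ?C"
      have "{y \<in> topspace X. (x, y) \<in> E} \<subseteq> ?C"
        unfolding eq by (rule closure_of_subset) auto
      then show "(x, v) \<in> W"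
        using v x by (auto simp: W_def)
    qed
    ultimately have "topspace X \<times> (topspace X - ?C) \<subseteq> W"
      by (intro open_in_one_section_imp_all[OF X min wm m W inv _ x]) auto
    then have "(y, y) \<in> W"
      using y by blast
    moreover have "(a 0 y, a 0 y) \<in> D"
      using D(2) flow_in_topspace[OF X] y by blast
    ultimately show False
      by (auto simp: W_def E_def prod_act_def)
  qed
qed

text \<open>
  Every proximal cell is residual, so by Baire's theorem it is dense and any two of them meet.
\<close>

lemma proximal_cells:
  assumes X: "flow X a" and min: "minimal X a" and wm: "weakly_mixing X a" and m: "invariant_mean X a m"
    and met: "metrizable_space X" and x: "x \<in> topspace X"
  shows proximal_cell_dense: "X closure_of proximal_cell X a x = topspace X"
    and proximal_cells_meet: "y \<in> topspace X \<Longrightarrow> \<exists>z. (x, z) \<in> proximal_relation X a \<and> (y, z) \<in> proximal_relation X a"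
proof -
  obtain W :: "nat \<Rightarrow> ('a \<times> 'a) set" where W: "\<And>n. openin (prod_topology X X) (W n)" "\<And>n x. x \<in> topspace X \<Longrightarrow> (x, x) \<in> W n"
    and prox: "\<And>x y. x \<in> topspace X \<Longrightarrow> y \<in> topspace X \<Longrightarrow> (\<And>n. \<exists>t. (a t x, a t y) \<in> W n) \<Longrightarrow> (x, y) \<in> proximal_relation X a"
    using metrizable_proximal_neighbourhoods[OF X met] by metis
  define G where "G x n = {y \<in> topspace X. \<exists>t. (a t x, a t y) \<in> W n}" for x n
  have G: "openin X (G x n) \<and> X closure_of (G x n) = topspace X" if "x \<in> topspace X" for x n
    unfolding G_def using near_cell_dense[OF X min wm m W(1) W(2) that] by auto
  have meet: "X closure_of \<Inter>(range (G x) \<union> range (G y)) = topspace X" if "y \<in> topspace X" for y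
    using G[OF x] G[OF that] by (intro compact_Hausdorff_Baire flow_compact[OF X] flow_Hausdorff[OF X]) auto
  have cell: "(y, z) \<in> proximal_relation X a" if "y \<in> topspace X" "\<And>n. z \<in> G y n" for y z
    using that by (intro prox) (auto simp: G_def)
  have "\<Inter>(range (G x) \<union> range (G x)) \<subseteq> proximal_cell X a x"
    using cell[OF x] by (auto simp: proximal_cell_def G_def)
  then show "X closure_of proximal_cell X a x = topspace X"
    using meet[OF x] closure_of_mono[of "\<Inter>(range (G x) \<union> range (G x))" "proximal_cell X a x" X]
      closure_of_subset_topspace[of X "proximal_cell X a x"] by simp
  show "\<exists>z. (x, z) \<in> proximal_relation X a \<and> (y, z) \<in> proximal_relation X a" if y: "y \<in> topspace X"
  proof -
    have "\<Inter>(range (G x) \<union> range (G y)) \<noteq> {}"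
      using meet[OF y] x by (metis closure_of_empty empty_iff)
    then obtain z where z: "z \<in> \<Inter>(range (G x) \<union> range (G y))"
      by (meson ex_in_conv)
    then have "(x, z) \<in> proximal_relation X a" "(y, z) \<in> proximal_relation X a"
      by (intro cell x y; auto)+
    then show ?thesis
      by blast
  qed
qed

section \<open>Weakly mixing flows of strongly amenable groups\<close>

lemma quasi_separable_weakly_mixing_factor:
  fixes X :: "'a topology" and act :: "'s::topological_group_add \<Rightarrow> 'a \<Rightarrow> 'a"
  assumes sa: "strongly_amenable TYPE('s)" and X: "flow X act" and pap: "pointwise_almost_periodic X act"
    and wm: "weakly_mixing X act" and qs: "quasi_separable TYPE('i) TYPE('b) X act" and nt: "\<not> trivial_flow X"
  obtains Y :: "'b topology" and b :: "'s \<Rightarrow> 'b \<Rightarrow> 'b" and f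
  where "flow Y b" "minimal Y b" "\<not> proximal Y b" "extension X act Y b f"
    "\<And>y. y \<in> topspace Y \<Longrightarrow> Y closure_of proximal_cell Y b y = topspace Y"
    "\<And>y y'. y \<in> topspace Y \<Longrightarrow> y' \<in> topspace Y \<Longrightarrow>
      \<exists>z. (y, z) \<in> proximal_relation Y b \<and> (y', z) \<in> proximal_relation Y b"
proof -
  obtain Y :: "'b topology" and b :: "'s \<Rightarrow> 'b \<Rightarrow> 'b" and f
    where Y: "flow Y b" "metrizable_space Y" "\<not> trivial_flow Y" and f: "extension X act Y b f"
    using quasi_separable_metrizable_factor[OF X qs nt] by metis
  have wmY: "weakly_mixing Y b"
    by (rule weakly_mixing_factor[OF f wm])
  have min: "minimal Y b"
    by (rule minimal_if_transitive_almost_periodic[OF Y(1,2) weakly_mixing_imp_transitive[OF wmY]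
          pointwise_almost_periodic_factor[OF X Y(1) f pap]])
  obtain m where "invariant_mean Y b m"
    using strongly_amenable_imp_invariant_mean[OF sa Y(1)] unfolding invariant_mean_def by metis
  note cells = proximal_cells[OF Y(1) min wmY this Y(2)]
  have "\<not> proximal Y b"
    using strongly_amenable_imp_trivial_flow[OF sa Y(1) min] Y(3) by blast
  from that[OF Y(1) min this f cells] show ?thesis .
qed

theorem theorem5p3p5:
  fixes X :: "'a topology"
    and act :: "'s::topological_group_add \<Rightarrow> 'a \<Rightarrow> 'a"
  assumes "strongly_amenable TYPE('s)"
    and "flow X act"
    and "pointwise_almost_periodic X act"
    and "weakly_mixing X act"
    and "quasi_separable TYPE('i) TYPE('b) X act"
    and "\<not> trivial_flow X"
  shows "\<not> equiv (topspace X) (proximal_relation X act) \<and>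
    (\<forall>x\<in>topspace X. \<not> closedin X (proximal_cell X act x)) \<and>
    \<not> point_distal X act"
proof -
  note X = \<open>flow X act\<close>
  obtain Y :: "'b topology" and b :: "'s \<Rightarrow> 'b \<Rightarrow> 'b" and f
    where Y: "flow Y b" and min: "minimal Y b" and not_prox: "\<not> proximal Y b" and f: "extension X act Y b f"
      and dense: "\<And>y. y \<in> topspace Y \<Longrightarrow> Y closure_of proximal_cell Y b y = topspace Y"
      and meet: "\<And>y y'. y \<in> topspace Y \<Longrightarrow> y' \<in> topspace Y \<Longrightarrow>
        \<exists>z. (y, z) \<in> proximal_relation Y b \<and> (y', z) \<in> proximal_relation Y b"
    using quasi_separable_weakly_mixing_factor[OF assms] by blast
  have "\<not> equiv (topspace X) (proximal_relation X act)"
  proof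
    assume eq: "equiv (topspace X) (proximal_relation X act)"
    have "(y, y') \<in> proximal_relation Y b" if yy: "y \<in> topspace Y" "y' \<in> topspace Y" for y y'
    proof -
      obtain z where z: "(y, z) \<in> proximal_relation Y b" "(y', z) \<in> proximal_relation Y b"
        using meet[OF yy] by blast
      then have "z \<in> f ` topspace X"
        unfolding extension_surj[OF f] by (auto simp: proximal_relation_def)
      \<comment> \<open>both pairs are lifted with the same point \<open>x\<close> over \<open>z\<close>, so that transitivity in \<open>X\<close> applies\<close>
      then obtain x where x: "x \<in> topspace X" "f x = z"
        by auto
      have zy: "(f x, y) \<in> proximal_relation Y b" "(f x, y') \<in> proximal_relation Y b"
        using z proximal_sym[OF Y] x(2) by auto
      obtain v where v: "(x, v) \<in> proximal_relation X act" "f v = y"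
        by (rule proximal_lift[OF X Y f min x(1) zy(1)])
      obtain v' where v': "(x, v') \<in> proximal_relation X act" "f v' = y'"
        by (rule proximal_lift[OF X Y f min x(1) zy(2)])
      have "(v, v') \<in> proximal_relation X act"
        using eq proximal_sym[OF X v(1)] v'(1) by (meson equivE transE)
      then show ?thesis
        using extension_proximal[OF X Y f] v(2) v'(2) by blast
    qed
    then have "proximal Y b"
      unfolding proximal_def using proximal_relation_subset[of Y b] by auto
    with not_prox show False
      by blast
  qed
  moreover have not_closed: "\<not> closedin X (proximal_cell X act x)" if x: "x \<in> topspace X" for x
  proof
    assume "closedin X (proximal_cell X act x)"
    from extension_closed_image[OF X Y f this]
    have "closedin Y (proximal_cell Y b (f x))"
      unfolding proximal_cell_factor[OF X Y f min x] .
    moreover have fx: "f x \<in> topspace Y"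
      using x extension_surj[OF f] by blast
    ultimately have "proximal_cell Y b (f x) = topspace Y"
      using dense[OF fx] by (simp add: closure_of_closedin)
    from proximal_if_full_cell[OF Y min fx this] not_prox show False
      by blast
  qed
  moreover have "\<not> point_distal X act"
  proof
    assume "point_distal X act"
    then obtain x where x: "x \<in> topspace X" "proximal_cell X act x = {x}"
      by (auto simp: point_distal_def)
    then show False
      using not_closed[OF x(1)] closedin_Hausdorff_singleton[OF flow_Hausdorff[OF X] x(1)] by simp
  qed
  ultimately show ?thesis
    by blast
qed

end
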